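(* Let $m\in\mathbb{N}=\{1,2,3,\dots\}$, and let $\mathscr{B}$ be a Banach algebra (with pointwise operations and norm $\|\cdot\|_{\mathscr{B}}$) such that (1) $\mathscr{P}\subset\mathscr{B}\subset\mathscr{H}^\infty$; (2) there exists $C>0$ such that $\|f\|_\infty\le C\|f\|_{\mathscr{B}}$ for all $f\in\mathscr{B}$; (3) $\mathscr{B}$ has the Wiener property: for all $f\in\mathscr{B}$ satisfying $\inf_{s\in\mathbb{C}_+}|f(s)|>0$, we have $\frac1f\in\mathscr{B}$. Then the maximal ideal space $\mathrm{M}(\partial^{-m}\mathscr{B})$ of $\partial^{-m}\mathscr{B}$ is homeomorphic to $\overline{\mathbb{D}}^{\mathbb{N}}$, where $\overline{\mathbb{D}}=\{z\in\mathbb{C}:|z|\le1\}$ has the Euclidean topology and $\overline{\mathbb{D}}^{\mathbb{N}}$ has the product topology.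
   Context: $\mathbb{C}_+=\{s\in\mathbb{C}:\mathrm{Re}(s)>0\}$. $\mathscr{H}^\infty$ is the set of all Dirichlet series $f(s)=\sum_{n=1}^\infty \frac{a_n}{n^s}$ ($a_n\in\mathbb{C}$) that converge at every $s\in\mathbb{C}_+$ and satisfy $\|f\|_\infty:=\sup_{s\in\mathbb{C}_+}|f(s)|<\infty$; it is a Banach algebra with pointwise operations and the norm $\|\cdot\|_\infty$. $\mathscr{P}\subset\mathscr{H}^\infty$ is the set of Dirichlet polynomials, i.e. Dirichlet series $\sum_{n=1}^N\frac{a_n}{n^s}$ with $N\in\mathbb{N}$, $a_1,\dots,a_N\in\mathbb{C}$. For $m\in\mathbb{N}$, $\partial^{-m}\mathscr{B}$ denotes the Banach algebra of all $f\in\mathscr{B}$ such that $f',\dots,f^{(m)}\in\mathscr{B}$ (derivatives with respect to $s\in\mathbb{C}_+$), with pointwise operations and the norm $\|f\|_{\partial^{-m}\mathscr{B}}=\sum_{\ell=0}^m\frac{1}{\ell!}\|f^{(\ell)}\|_{\mathscr{B}}$. For a commutative unital complex Banach algebra $A$, the maximal ideal space $\mathrm{M}(A)$ is the set of nonzero multiplicative continuous linear functionals $A\to\mathbb{C}$, with the Gelfand topology (the weak-$*$ topology inherited from the dual $A^*$). *)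

theory Defs
  imports "HOL-Analysis.Analysis"
begin

section \<open>Banach algebras of complex functions with pointwise operations\<close>

text \<open>
  A function on a set \<open>\<Omega>\<close> is represented by its unique extensional representative, i.e. the one
  that is \<open>undefined\<close> off \<open>\<Omega>\<close>, so that equality in HOL is equality on \<open>\<Omega>\<close>.
\<close>

text \<open>
  The cut-off outside \<open>A\<close> only makes this a metric in the sense of the locale \<open>Metric_space\<close>, which
  demands nonnegativity and symmetry also off the carrier; \<open>nrm\<close> is unconstrained there.
\<close>

definition norm_dist ::
  "'a set \<Rightarrow> ('a \<Rightarrow> complex) set \<Rightarrow> (('a \<Rightarrow> complex) \<Rightarrow> real) \<Rightarrow>
    ('a \<Rightarrow> complex) \<Rightarrow> ('a \<Rightarrow> complex) \<Rightarrow> real" where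
  "norm_dist \<Omega> A nrm f g = (if f \<in> A \<and> g \<in> A then nrm (\<lambda>s\<in>\<Omega>. f s - g s) else 0)"

text \<open>
  No unit is required here, and if there is one its norm need not be 1.
\<close>

locale function_banach_algebra =
  fixes \<Omega> :: "'a set"
    and A :: "('a \<Rightarrow> complex) set"
    and nrm :: "('a \<Rightarrow> complex) \<Rightarrow> real"
  assumes extensional: "A \<subseteq> extensional \<Omega>"
    and zero_closed: "(\<lambda>s\<in>\<Omega>. 0) \<in> A"
    and add_closed: "f \<in> A \<Longrightarrow> g \<in> A \<Longrightarrow> (\<lambda>s\<in>\<Omega>. f s + g s) \<in> A"
    and scale_closed: "f \<in> A \<Longrightarrow> (\<lambda>s\<in>\<Omega>. c * f s) \<in> A"
    and mult_closed: "f \<in> A \<Longrightarrow> g \<in> A \<Longrightarrow> (\<lambda>s\<in>\<Omega>. f s * g s) \<in> A"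
    and norm_nonneg: "f \<in> A \<Longrightarrow> 0 \<le> nrm f"
    and norm_eq_zero_iff: "f \<in> A \<Longrightarrow> nrm f = 0 \<longleftrightarrow> f = (\<lambda>s\<in>\<Omega>. 0)"
    and norm_scale: "f \<in> A \<Longrightarrow> nrm (\<lambda>s\<in>\<Omega>. c * f s) = cmod c * nrm f"
    and norm_triangle: "f \<in> A \<Longrightarrow> g \<in> A \<Longrightarrow> nrm (\<lambda>s\<in>\<Omega>. f s + g s) \<le> nrm f + nrm g"
    and norm_mult: "f \<in> A \<Longrightarrow> g \<in> A \<Longrightarrow> nrm (\<lambda>s\<in>\<Omega>. f s * g s) \<le> nrm f * nrm g"
    and complete: "Metric_space.mcomplete A (norm_dist \<Omega> A nrm)"

text \<open>
  Functionals on \<open>A\<close> are extensional as well, so that they are points of the product of copies of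
  the complex plane indexed by \<open>A\<close>. The weak-* topology, being the coarsest one on the dual for which
  all evaluations at elements of \<open>A\<close> are continuous, is the subspace topology from that product.
\<close>

definition dual_space ::
  "'a set \<Rightarrow> ('a \<Rightarrow> complex) set \<Rightarrow> (('a \<Rightarrow> complex) \<Rightarrow> real) \<Rightarrow> (('a \<Rightarrow> complex) \<Rightarrow> complex) set" where
  "dual_space \<Omega> A nrm = {\<phi> \<in> extensional A.
     (\<forall>f\<in>A. \<forall>g\<in>A. \<phi> (\<lambda>s\<in>\<Omega>. f s + g s) = \<phi> f + \<phi> g) \<and>
     (\<forall>c. \<forall>f\<in>A. \<phi> (\<lambda>s\<in>\<Omega>. c * f s) = c * \<phi> f) \<and>
     continuous_map (Metric_space.mtopology A (norm_dist \<Omega> A nrm)) euclidean \<phi>}"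

definition weak_star_topology ::
  "'a set \<Rightarrow> ('a \<Rightarrow> complex) set \<Rightarrow> (('a \<Rightarrow> complex) \<Rightarrow> real) \<Rightarrow> (('a \<Rightarrow> complex) \<Rightarrow> complex) topology" where
  "weak_star_topology \<Omega> A nrm =
     subtopology (product_topology (\<lambda>_. euclidean) A) (dual_space \<Omega> A nrm)"

definition maximal_ideal_space ::
  "'a set \<Rightarrow> ('a \<Rightarrow> complex) set \<Rightarrow> (('a \<Rightarrow> complex) \<Rightarrow> real) \<Rightarrow> (('a \<Rightarrow> complex) \<Rightarrow> complex) topology" where
  "maximal_ideal_space \<Omega> A nrm =
     subtopology (weak_star_topology \<Omega> A nrm)
       {\<phi> \<in> dual_space \<Omega> A nrm.
          (\<exists>f\<in>A. \<phi> f \<noteq> 0) \<and> (\<forall>f\<in>A. \<forall>g\<in>A. \<phi> (\<lambda>s\<in>\<Omega>. f s * g s) = \<phi> f * \<phi> g)}"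


section \<open>Dirichlet series on the right half-plane\<close>

definition right_half_plane :: "complex set"  (\<open>\<complex>\<^sub>+\<close>) where
  "\<complex>\<^sub>+ = {s. Re s > 0}"

text \<open>
  The series run over \<open>n \<ge> 1\<close>, whence the index shift. Convergence is that of partial sums,
  not absolute convergence.
\<close>

definition H_infty :: "(complex \<Rightarrow> complex) set" where
  "H_infty = {f \<in> extensional \<complex>\<^sub>+.
     (\<exists>a :: nat \<Rightarrow> complex. \<forall>s\<in>\<complex>\<^sub>+. (\<lambda>n. a (Suc n) / of_nat (Suc n) powr s) sums f s) \<and>
     bounded (f ` \<complex>\<^sub>+)}"

definition sup_norm :: "(complex \<Rightarrow> complex) \<Rightarrow> real" where
  "sup_norm f = (SUP s\<in>\<complex>\<^sub>+. cmod (f s))"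

definition dirichlet_polynomials :: "(complex \<Rightarrow> complex) set" where
  "dirichlet_polynomials =
     {(\<lambda>s\<in>\<complex>\<^sub>+. \<Sum>n=1..N. a n / of_nat n powr s) | (N :: nat) (a :: nat \<Rightarrow> complex). N \<ge> 1}"

definition wiener_property :: "(complex \<Rightarrow> complex) set \<Rightarrow> bool" where
  "wiener_property B \<longleftrightarrow>
     (\<forall>f\<in>B. (INF s\<in>\<complex>\<^sub>+. cmod (f s)) > 0 \<longrightarrow> (\<lambda>s\<in>\<complex>\<^sub>+. 1 / f s) \<in> B)"

text \<open>
  As \<open>\<complex>\<^sub>+\<close> is open, \<open>deriv\<close> at a point of \<open>\<complex>\<^sub>+\<close> does not see the values of the function off \<open>\<complex>\<^sub>+\<close>.
\<close>

definition nth_deriv :: "nat \<Rightarrow> (complex \<Rightarrow> complex) \<Rightarrow> complex \<Rightarrow> complex" where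
  "nth_deriv l f = restrict ((deriv ^^ l) f) \<complex>\<^sub>+"

definition deriv_algebra :: "nat \<Rightarrow> (complex \<Rightarrow> complex) set \<Rightarrow> (complex \<Rightarrow> complex) set" where
  "deriv_algebra m B = {f \<in> B. \<forall>l\<in>{1..m}. nth_deriv l f \<in> B}"

definition deriv_norm ::
  "nat \<Rightarrow> ((complex \<Rightarrow> complex) \<Rightarrow> real) \<Rightarrow> (complex \<Rightarrow> complex) \<Rightarrow> real" where
  "deriv_norm m nrm f = (\<Sum>l=0..m. 1 / fact l * nrm (nth_deriv l f))"

end

(*
  Write A for the algebra of the f in B with f', ..., f^(m) in B. It is closed under inverses of
  functions bounded away from 0, because B has the Wiener property, so every character phi of A
  satisfies |phi f| <= sup |f|. As m >= 1, each f in A has a bounded derivative; convolving f with a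
  narrow Gaussian along vertical lines therefore changes it little uniformly, while multiplying its
  n-th coefficient by exp(- (d log n)^2 / 2), after which the series converges uniformly on the
  half-plane. So f is a uniform limit of Dirichlet polynomials, and phi is determined by the numbers
  phi(p^-s), p prime, of modulus at most 1. Conversely, by Kronecker's theorem (the logarithms of the
  primes are linearly independent) and the maximum principle, substituting z_p for p^-s in a Dirichlet
  polynomial does not increase its supremum when all |z_p| <= 1, so every point of the polydisc
  defines a character by uniform extension. Both directions are continuous.
*)
theory Submission
  imports Defs "HOL-Complex_Analysis.Complex_Analysis" "HOL-Probability.Probability" "HOL-Real_Asymp.Real_Asymp"
begin

section \<open>Dirichlet series in the right half-plane\<close>

text \<open>A member of \<open>H_infty\<close> need not be a uniform limit of Dirichlet polynomials:
  such limits are uniformly continuous on the half-plane, and bounded Dirichlet series in general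
  are not. A bounded derivative removes this obstacle, but near the imaginary axis the series may
  converge only conditionally, so smoothing cannot be computed there term by term. Convergence at s
  = 1 alone gives a_n = O(n), and for Re s > 3 this justifies termwise integration against the
  Gaussian. The new coefficients decay faster than every power of n, so the new series is
  holomorphic on the whole half-plane, and the identity theorem spreads the equality. Approximation
  takes place in the supremum norm only; density of the Dirichlet polynomials in the norm of the
  algebra is never claimed. This suffices in both directions: characters are contractions for the
  supremum norm, and the functional of a point of the polydisc, bounded by the supremum, is
  continuous because C times the norm of the algebra dominates the supremum.\<close>

lemma open_right_half_plane: "open \<complex>\<^sub>+"
  unfolding right_half_plane_def by (rule open_halfspace_Re_gt)

lemma convex_right_half_plane: "convex \<complex>\<^sub>+"
  unfolding right_half_plane_def by (rule convex_halfspace_Re_gt)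

lemma norm_of_nat_powr: "n > 0 \<Longrightarrow> norm (of_nat n powr s :: complex) = real n powr Re s"
  using norm_powr_real_powr[of "of_nat n" s] by simp

text \<open>Mean value inequality for z powr (-w) on the segment from n to n + 1. The difference
  gains a factor 1/n over the size of its two terms, which makes the series obtained by summation by
  parts absolutely convergent.\<close>

lemma norm_powr_diff_Suc_le:
  fixes w :: complex
  assumes "Re w > 0" "n > 0"
  shows "norm (of_nat n powr (-w) - of_nat (Suc n) powr (-w)) \<le> norm w * real n powr (- 1 - Re w)"
proof -
  let ?S = "closed_segment (of_nat n :: complex) (of_nat (Suc n))"
  have seg: "Im z = 0 \<and> Re z \<ge> real n" if "z \<in> ?S" for z
  proof -
    have "of_nat n = of_real (real n)" "of_nat (Suc n) = of_real (real (Suc n))" for n :: nat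
      by simp_all
    then have "z \<in> closed_segment (of_real (real n)) (of_real (real (Suc n)))" using that by metis
    then obtain x where "z = of_real x" "x \<in> closed_segment (real n) (real (Suc n))"
      by (auto simp only: closed_segment_of_real image_iff)
    then show ?thesis by (auto simp: closed_segment_eq_real_ivl)
  qed
  have pos: "z \<notin> \<real>\<^sub>\<le>\<^sub>0" if "z \<in> ?S" for z
    using seg[OF that] assms by (auto simp: complex_nonpos_Reals_iff)
  have "norm (of_nat n powr (-w) - of_nat (Suc n) powr (-w))
      \<le> (norm w * real n powr (- 1 - Re w)) * norm (of_nat n - of_nat (Suc n) :: complex)"
  proof (rule field_differentiable_bound[of ?S _ "\<lambda>z. (-w) * z powr (-w - 1)"])
    fix z assume z: "z \<in> ?S"
    show "((\<lambda>z. z powr (-w)) has_field_derivative (-w) * z powr (-w - 1)) (at z within ?S)"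
      by (rule has_field_derivative_at_within, rule has_field_derivative_powr) (rule pos[OF z])
    have "z = of_real (Re z)" using seg[OF z] by (simp add: complex_eq_iff)
    then have "norm (z powr (-w - 1)) = Re z powr (-Re w - 1)"
      using seg[OF z] assms norm_powr_real_powr[of z "-w-1"]
      by (metis (no_types, opaque_lifting) Reals_of_real complex_Re_of_nat minus_complex.simps(1) of_nat_0_le_iff one_complex.simps(1) order_trans uminus_complex.simps(1))
    also have "\<dots> \<le> real n powr (-Re w - 1)"
      by (rule powr_mono2') (use seg[OF z] assms in auto)
    also have "- Re w - 1 = - 1 - Re w" by simp
    finally show "norm ((-w) * z powr (-w - 1)) \<le> norm w * real n powr (- 1 - Re w)"
      unfolding norm_mult norm_minus_cancel by (intro mult_left_mono) simp_all
  qed auto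
  then show ?thesis by (simp add: norm_minus_commute)
qed

lemma summation_by_parts:
  fixes b c :: "nat \<Rightarrow> 'a::comm_ring"
  defines "S \<equiv> \<lambda>n. \<Sum>k<n. b k"
  shows "(\<Sum>k<N. b k * c k) = S N * c N + (\<Sum>k<N. S (Suc k) * (c k - c (Suc k)))"
  by (induction N) (auto simp: S_def algebra_simps)

lemma powr_shift_sequentially:
  "e > 0 \<Longrightarrow> (\<lambda>n. real (Suc n) powr (- e)) \<longlonglongrightarrow> 0"
  by real_asymp

text \<open>Abel summation against the convergent series at \<open>s0\<close>, whose partial sums
  are bounded by some K. The boundary term is at most K N^(-e), and the summed differences are
  dominated by K R n^(-1-e). Both bounds depend on s only through e and R.\<close>

lemma dirichlet_series_uniform_limit:
  fixes a :: "nat \<Rightarrow> complex"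
  assumes sums: "(\<lambda>n. a (Suc n) / of_nat (Suc n) powr s0) sums l"
    and e: "e > 0" and D: "\<And>s. s \<in> D \<Longrightarrow> Re s \<ge> Re s0 + e" "\<And>s. s \<in> D \<Longrightarrow> norm (s - s0) \<le> R"
    and f: "\<And>s. s \<in> D \<Longrightarrow> (\<lambda>n. a (Suc n) / of_nat (Suc n) powr s) sums f s"
  shows "uniform_limit D (\<lambda>N s. \<Sum>k<N. a (Suc k) / of_nat (Suc k) powr s) f sequentially"
proof -
  define b where "b k = a (Suc k) / of_nat (Suc k) powr s0" for k
  define S where "S n = (\<Sum>k<n. b k)" for n
  define c where "c s k = (of_nat (Suc k) powr (- (s - s0)) :: complex)" for s k
  have "convergent S" using sums unfolding sums_def S_def b_def convergent_def by auto
  then obtain K where K: "\<And>n. norm (S n) \<le> K"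
    using convergent_imp_Bseq Bseq_def by blast
  have K0: "K \<ge> 0" using K[of 0] by (simp add: S_def)
  have eq: "(\<Sum>k<N. a (Suc k) / of_nat (Suc k) powr s)
        = S N * c s N + (\<Sum>k<N. S (Suc k) * (c s k - c s (Suc k)))" for s N
  proof -
    have "a (Suc k) / of_nat (Suc k) powr s = b k * c s k" for k
      unfolding b_def c_def powr_minus powr_diff
      by (simp add: field_simps del: of_nat_Suc)
    then show ?thesis using summation_by_parts[of b "c s" N] by (simp add: S_def)
  qed
  have lim1: "uniform_limit D (\<lambda>N s. S N * c s N) (\<lambda>s. 0) sequentially"
  proof (rule uniform_limitI)
    fix d :: real assume d: "d > 0"
    have "(\<lambda>n. K * real (Suc n) powr (- e)) \<longlonglongrightarrow> K * 0"
      by (intro tendsto_mult_left powr_shift_sequentially e)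
    then have "\<forall>\<^sub>F n in sequentially. K * real (Suc n) powr (- e) < d"
      using d by (auto dest: order_tendstoD)
    then show "\<forall>\<^sub>F n in sequentially. \<forall>s\<in>D. dist (S n * c s n) 0 < d"
    proof eventually_elim
      case (elim n)
      show ?case
      proof
        fix s assume s: "s \<in> D"
        have "norm (c s n) = real (Suc n) powr (- (Re s - Re s0))"
          unfolding c_def by (subst norm_of_nat_powr) auto
        also have "\<dots> \<le> real (Suc n) powr (- e)"
          using D(1)[OF s] by (intro powr_mono) auto
        finally have "norm (S n * c s n) \<le> K * real (Suc n) powr (- e)"
          unfolding norm_mult using K K0 by (intro mult_mono) auto
        then show "dist (S n * c s n) 0 < d" using elim by simp
      qed
    qed
  qed
  have lim2: "uniform_limit D (\<lambda>N s. \<Sum>k<N. S (Suc k) * (c s k - c s (Suc k)))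
      (\<lambda>s. \<Sum>k. S (Suc k) * (c s k - c s (Suc k))) sequentially"
  proof (rule Weierstrass_m_test)
    show "summable (\<lambda>n. K * (R * real (Suc n) powr (- 1 - e)))"
      using e summable_Suc_iff[of "\<lambda>n. real n powr (- 1 - e)"]
      by (intro summable_mult) (simp add: summable_real_powr_iff del: of_nat_Suc)
    fix n s assume s: "s \<in> D"
    have "norm (c s n - c s (Suc n)) \<le> norm (s - s0) * real (Suc n) powr (- 1 - Re (s - s0))"
      unfolding c_def by (rule norm_powr_diff_Suc_le) (use D(1)[OF s] e in auto)
    also have "\<dots> \<le> R * real (Suc n) powr (- 1 - e)"
      using D[OF s] order_trans[OF norm_ge_zero D(2)[OF s]] by (intro mult_mono powr_mono) auto
    finally show "norm (S (Suc n) * (c s n - c s (Suc n))) \<le> K * (R * real (Suc n) powr (- 1 - e))"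
      unfolding norm_mult using K K0 by (intro mult_mono) auto
  qed
  define g where "g = (\<lambda>s. \<Sum>k. S (Suc k) * (c s k - c s (Suc k)))"
  have lim: "uniform_limit D (\<lambda>N s. \<Sum>k<N. a (Suc k) / of_nat (Suc k) powr s) g sequentially"
    unfolding eq using uniform_limit_add[OF lim1 lim2] by (simp add: g_def)
  moreover have "g s = f s" if "s \<in> D" for s
    using tendsto_uniform_limitI[OF lim that] f[OF that] unfolding sums_def
    by (metis LIMSEQ_unique)
  ultimately show ?thesis
    by (metis (mono_tags, lifting) uniform_limit_cong')
qed

lemma dirichlet_series_holomorphic:
  fixes a :: "nat \<Rightarrow> complex"
  assumes f: "\<And>s. s \<in> \<complex>\<^sub>+ \<Longrightarrow> (\<lambda>n. a (Suc n) / of_nat (Suc n) powr s) sums f s"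
  shows "f holomorphic_on \<complex>\<^sub>+"
proof (rule holomorphic_uniform_sequence[OF open_right_half_plane])
  fix N show "(\<lambda>s. \<Sum>k<N. a (Suc k) / of_nat (Suc k) powr s) holomorphic_on \<complex>\<^sub>+"
    by (intro holomorphic_intros) (auto simp del: of_nat_Suc)
next
  fix x assume x: "x \<in> \<complex>\<^sub>+"
  \<comment> \<open>With a quarter of Re x as radius, the real part is at least 3d on the closed
    disc, which leaves the required margin d above the base point d of the Abel summation.\<close>
  define d where "d = Re x / 4"
  have d: "d > 0" using x by (simp add: d_def right_half_plane_def)
  have re: "Re s \<ge> 3 * d" if "s \<in> cball x d" for s
  proof -
    have "Re x - Re s \<le> d"
      using that abs_Re_le_cmod[of "x - s"] by (simp add: dist_norm)
    then show ?thesis by (simp add: d_def)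
  qed
  have sub: "cball x d \<subseteq> \<complex>\<^sub>+" using re d by (force simp: right_half_plane_def)
  have "uniform_limit (cball x d) (\<lambda>N s. \<Sum>k<N. a (Suc k) / of_nat (Suc k) powr s) f sequentially"
  proof (rule dirichlet_series_uniform_limit[where e = d and R = "norm (x - of_real d) + d"])
    show "(\<lambda>n. a (Suc n) / of_nat (Suc n) powr (of_real d)) sums f (of_real d)"
      by (rule f) (use d in \<open>simp add: right_half_plane_def\<close>)
    fix s assume s: "s \<in> cball x d"
    show "Re s \<ge> Re (of_real d) + d" using re[OF s] d by simp
    show "norm (s - of_real d) \<le> norm (x - of_real d) + d"
      using s norm_triangle_ineq[of "x - of_real d" "s - x"] by (simp add: dist_norm norm_minus_commute)
    show "(\<lambda>n. a (Suc n) / of_nat (Suc n) powr s) sums f s" using f s sub by blast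
  qed (use d in auto)
  then show "\<exists>d>0. cball x d \<subseteq> \<complex>\<^sub>+ \<and>
      uniform_limit (cball x d) (\<lambda>N s. \<Sum>k<N. a (Suc k) / of_nat (Suc k) powr s) f sequentially"
    using d sub by blast
qed

lemma H_infty_holomorphic: "f \<in> H_infty \<Longrightarrow> f holomorphic_on \<complex>\<^sub>+"
  unfolding H_infty_def using dirichlet_series_holomorphic by blast

section \<open>Gaussian smoothing along vertical lines\<close>

lemma vertical_shift_right_half_plane [simp]: "s + \<i> * of_real x \<in> \<complex>\<^sub>+ \<longleftrightarrow> s \<in> \<complex>\<^sub>+"
  by (simp add: right_half_plane_def)

interpretation std_normal: prob_space std_normal_distribution
  by (rule prob_space_normal_density) simp

lemma lipschitz_of_bounded_deriv:
  assumes "f holomorphic_on \<complex>\<^sub>+" "\<And>s. s \<in> \<complex>\<^sub>+ \<Longrightarrow> norm (deriv f s) \<le> K" "x \<in> \<complex>\<^sub>+" "y \<in> \<complex>\<^sub>+"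
  shows "norm (f x - f y) \<le> K * norm (x - y)"
proof (rule field_differentiable_bound[OF convex_right_half_plane _ assms(2-4)])
  fix z assume "z \<in> \<complex>\<^sub>+"
  then show "(f has_field_derivative deriv f z) (at z within \<complex>\<^sub>+)"
    by (rule has_field_derivative_at_within[OF holomorphic_derivI[OF assms(1) open_right_half_plane]])
qed

lemma vertical_section_measurable:
  fixes g :: "complex \<Rightarrow> complex"
  assumes "continuous_on \<complex>\<^sub>+ g" "s \<in> \<complex>\<^sub>+"
  shows "(\<lambda>t. g (s + \<i> * of_real (d * t))) \<in> borel_measurable std_normal_distribution"
proof -
  have "continuous_on UNIV (\<lambda>t. g (s + \<i> * of_real (d * t)))"
  proof (rule continuous_on_compose2[OF assms(1)])
    show "continuous_on UNIV (\<lambda>t. s + \<i> * of_real (d * t))"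
      by (intro continuous_intros)
    show "range (\<lambda>t. s + \<i> * of_real (d * t)) \<subseteq> \<complex>\<^sub>+"
      using assms(2) by (simp only: vertical_shift_right_half_plane image_subset_iff) simp
  qed
  from borel_measurable_continuous_onI[OF this] show ?thesis by simp
qed

lemma vertical_section_integrable:
  fixes g :: "complex \<Rightarrow> complex"
  assumes "continuous_on \<complex>\<^sub>+ g" "s \<in> \<complex>\<^sub>+" "\<And>s. s \<in> \<complex>\<^sub>+ \<Longrightarrow> norm (g s) \<le> L"
  shows "integrable std_normal_distribution (\<lambda>t. g (s + \<i> * of_real (d * t)))"
proof (rule std_normal.integrable_const_bound[where B = L])
  show "AE t in std_normal_distribution. norm (g (s + \<i> * of_real (d * t))) \<le> L"
    by (intro AE_I2 assms(3)) (simp only: vertical_shift_right_half_plane assms(2))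
qed (rule vertical_section_measurable[OF assms(1,2)])

definition gauss_smooth :: "real \<Rightarrow> (complex \<Rightarrow> complex) \<Rightarrow> complex \<Rightarrow> complex" where
  "gauss_smooth d f s = (LINT t|std_normal_distribution. f (s + \<i> * of_real (d * t)))"

text \<open>Differentiation under the integral sign: the difference quotients converge pointwise to
  the derivative and are all dominated by the Lipschitz constant K. The limit is tested along
  sequences so that dominated convergence applies.\<close>

lemma gauss_smooth_holomorphic:
  assumes hol: "f holomorphic_on \<complex>\<^sub>+"
    and L: "\<And>s. s \<in> \<complex>\<^sub>+ \<Longrightarrow> norm (f s) \<le> L"
    and K: "\<And>s. s \<in> \<complex>\<^sub>+ \<Longrightarrow> norm (deriv f s) \<le> K"
  shows "gauss_smooth d f holomorphic_on \<complex>\<^sub>+"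
proof (rule holomorphic_onI)
  fix s assume s: "s \<in> \<complex>\<^sub>+"
  note cont = holomorphic_on_imp_continuous_on[OF hol]
  have cont': "continuous_on \<complex>\<^sub>+ (deriv f)"
    by (intro holomorphic_on_imp_continuous_on holomorphic_deriv hol open_right_half_plane)
  have "((\<lambda>y. (gauss_smooth d f y - gauss_smooth d f s) / (y - s)) \<longlongrightarrow> gauss_smooth d (deriv f) s)
      (at s within \<complex>\<^sub>+)"
    unfolding tendsto_at_iff_sequentially
  proof (intro allI impI)
    fix X :: "nat \<Rightarrow> complex" assume X: "\<forall>i. X i \<in> \<complex>\<^sub>+ - {s}" "X \<longlonglongrightarrow> s"
    define q where "q i t = (f (X i + \<i> * of_real (d * t)) - f (s + \<i> * of_real (d * t))) / (X i - s)" for i t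
    have eq: "(gauss_smooth d f (X i) - gauss_smooth d f s) / (X i - s) = (LINT t|std_normal_distribution. q i t)" for i
    proof -
      have int: "integrable std_normal_distribution (\<lambda>t. f (y + \<i> * of_real (d * t)))" if "y \<in> \<complex>\<^sub>+" for y
        by (rule vertical_section_integrable[OF cont that L])
      show ?thesis
        unfolding gauss_smooth_def q_def using X(1) s by (simp add: int del: of_real_mult)
    qed
    have "(\<lambda>i. LINT t|std_normal_distribution. q i t) \<longlonglongrightarrow> gauss_smooth d (deriv f) s"
      unfolding gauss_smooth_def
    proof (rule integral_dominated_convergence[where w = "\<lambda>_. K"])
      show "(\<lambda>t. deriv f (s + \<i> * of_real (d * t))) \<in> borel_measurable std_normal_distribution"
        by (rule vertical_section_measurable[OF cont' s])
      show "q i \<in> borel_measurable std_normal_distribution" for i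
        unfolding q_def using X(1) s
        by (intro borel_measurable_divide borel_measurable_diff borel_measurable_const vertical_section_measurable cont) auto
      show "AE t in std_normal_distribution. (\<lambda>i. q i t) \<longlonglongrightarrow> deriv f (s + \<i> * of_real (d * t))"
      proof (rule AE_I2)
        fix t
        let ?c = "\<i> * complex_of_real (d * t)"
        have "(f has_field_derivative deriv f (s + ?c)) (at (s + ?c))"
          by (rule holomorphic_derivI[OF hol open_right_half_plane]) (use s in \<open>simp del: of_real_mult\<close>)
        then have lim: "((\<lambda>y. (f y - f (s + ?c)) / (y - (s + ?c))) \<longlongrightarrow> deriv f (s + ?c)) (at (s + ?c))"
          by (simp only: has_field_derivative_iff)
        have "(\<lambda>i. X i + ?c) \<longlonglongrightarrow> s + ?c" by (intro tendsto_intros X)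
        moreover have "\<forall>i. X i + ?c \<in> UNIV - {s + ?c}" using X(1) by auto
        ultimately have "((\<lambda>y. (f y - f (s + ?c)) / (y - (s + ?c))) \<circ> (\<lambda>i. X i + ?c)) \<longlonglongrightarrow> deriv f (s + ?c)"
          using lim[unfolded tendsto_at_iff_sequentially, THEN spec[where x = "\<lambda>i. X i + ?c"]]
          by (metis (no_types, lifting))
        then show "(\<lambda>i. q i t) \<longlonglongrightarrow> deriv f (s + ?c)" by (simp add: o_def q_def del: of_real_mult)
      qed
      show "AE t in std_normal_distribution. norm (q i t) \<le> K" for i
      proof (rule AE_I2)
        fix t
        have "norm (f (X i + \<i> * of_real (d * t)) - f (s + \<i> * of_real (d * t)))
            \<le> K * norm ((X i + \<i> * of_real (d * t)) - (s + \<i> * of_real (d * t)))"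
          by (rule lipschitz_of_bounded_deriv[OF hol K]) (use X(1) s in \<open>auto simp del: of_real_mult\<close>)
        then show "norm (q i t) \<le> K"
          using X(1) by (simp add: q_def norm_divide divide_le_eq del: of_real_mult)
      qed
    qed auto
    then show "((\<lambda>y. (gauss_smooth d f y - gauss_smooth d f s) / (y - s)) \<circ> X) \<longlonglongrightarrow> gauss_smooth d (deriv f) s"
      by (simp add: o_def eq)
  qed
  then show "gauss_smooth d f field_differentiable at s within \<complex>\<^sub>+"
    unfolding field_differentiable_def has_field_derivative_iff by blast
qed

text \<open>The value of f moves by at most K d |t| along the vertical line, and the Gaussian has
  total mass 1; the last factor is its first absolute moment.\<close>

lemma gauss_smooth_dist_le:
  assumes hol: "f holomorphic_on \<complex>\<^sub>+"
    and L: "\<And>s. s \<in> \<complex>\<^sub>+ \<Longrightarrow> norm (f s) \<le> L"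
    and K: "\<And>s. s \<in> \<complex>\<^sub>+ \<Longrightarrow> norm (deriv f s) \<le> K"
    and s: "s \<in> \<complex>\<^sub>+" and d: "d \<ge> 0"
  shows "norm (gauss_smooth d f s - f s) \<le> d * K * (LINT t|std_normal_distribution. \<bar>t\<bar>)"
proof -
  note cont = holomorphic_on_imp_continuous_on[OF hol]
  have K0: "K \<ge> 0" using K[OF s] norm_ge_zero order_trans by blast
  have int: "integrable std_normal_distribution (\<lambda>t. f (s + \<i> * of_real (d * t)))"
    by (rule vertical_section_integrable[OF cont s L])
  have abs_int: "integrable std_normal_distribution (\<lambda>t. \<bar>t\<bar>)"
    by (subst integrable_density)
       (use integrable_std_normal_moment_abs[of 1] in \<open>auto intro!: AE_I2 normal_density_nonneg\<close>)
  have "gauss_smooth d f s - f s = (LINT t|std_normal_distribution. f (s + \<i> * of_real (d * t)) - f s)"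
    unfolding gauss_smooth_def
    by (subst Bochner_Integration.integral_diff[OF int]) (use std_normal.prob_space in auto)
  also have "norm \<dots> \<le> (LINT t|std_normal_distribution. d * K * \<bar>t\<bar>)"
  proof (rule Bochner_Integration.integral_norm_bound_integral)
    show "integrable std_normal_distribution (\<lambda>t. f (s + \<i> * of_real (d * t)) - f s)"
      using int by auto
    show "integrable std_normal_distribution (\<lambda>t. d * K * \<bar>t\<bar>)" using abs_int by auto
    fix t
    have "norm (f (s + \<i> * of_real (d * t)) - f s) \<le> K * norm ((s + \<i> * of_real (d * t)) - s)"
      by (rule lipschitz_of_bounded_deriv[OF hol K]) (use s in \<open>auto simp del: of_real_mult\<close>)
    then show "norm (f (s + \<i> * of_real (d * t)) - f s) \<le> d * K * \<bar>t\<bar>"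
      using d by (simp add: norm_mult abs_mult mult_ac)
  qed
  finally show ?thesis by simp
qed

section \<open>The coefficients of the smoothed function and uniform approximation\<close>

lemma dirichlet_coefficients_linear_growth:
  fixes a :: "nat \<Rightarrow> complex"
  assumes "summable (\<lambda>n. a (Suc n) / of_nat (Suc n) powr 1)"
  obtains A where "A \<ge> 0" "\<And>n. norm (a (Suc n)) \<le> A * real (Suc n)"
proof -
  obtain A where A: "\<And>n. norm (a (Suc n) / of_nat (Suc n) powr 1) \<le> A"
    using convergent_imp_Bseq[OF convergentI[OF summable_LIMSEQ_zero[OF assms]]] unfolding Bseq_def by blast
  have "norm (a (Suc n)) \<le> A * real (Suc n)" for n
    using A[of n] by (simp add: norm_divide divide_le_eq del: of_nat_Suc)
  moreover have "A \<ge> 0" using A[of 0] norm_ge_zero order_trans by blast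
  ultimately show ?thesis using that by blast
qed

lemma gaussian_log_weights_summable:
  assumes "d > 0"
  shows "summable (\<lambda>n. real (Suc n) * exp (- ((d * ln (real (Suc n)))\<^sup>2) / 2))"
proof (rule summable_comparison_test_bigo)
  show "summable (\<lambda>n. norm (1 / real (Suc n) ^ 2))"
    using summable_Suc_iff[of "\<lambda>n. 1 / real n ^ 2"] inverse_power_summable[of 2, where ?'a = real]
    by (simp add: divide_inverse power_inverse del: of_nat_Suc)
  show "(\<lambda>n. real (Suc n) * exp (- ((d * ln (real (Suc n)))\<^sup>2) / 2)) \<in> O(\<lambda>n. 1 / real (Suc n) ^ 2)"
    using assms by real_asymp
qed

text \<open>As a function of t, n powr (-i d t) is exp(i u t) with u = -d ln n, so the integral is
  the characteristic function of the standard normal law at u.\<close>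

lemma integral_powr_std_normal:
  assumes "n > 0"
  shows "(LINT t|std_normal_distribution. c / of_nat n powr (s + \<i> * of_real (d * t)))
       = c * exp (- of_real ((d * ln (real n))\<^sup>2 / 2)) / of_nat n powr s"
proof -
  have "c / of_nat n powr (s + \<i> * of_real (d * t)) = c / of_nat n powr s * iexp ((- d * ln (real n)) * t)" for t
  proof -
    have "of_nat n powr (\<i> * of_real (d * t)) = exp (- (\<i> * of_real ((- d * ln (real n)) * t)))"
      using assms by (simp add: powr_def Ln_of_nat mult_ac)
    then show ?thesis by (simp add: powr_add exp_minus field_simps)
  qed
  moreover have "(LINT t|std_normal_distribution. c / of_nat n powr s * iexp ((- d * ln (real n)) * t))
      = c / of_nat n powr s * char std_normal_distribution (- d * ln (real n))"
    unfolding char_def by (rule integral_mult_right_zero)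
  ultimately show ?thesis
    unfolding char_std_normal_distribution by (simp add: exp_of_real[symmetric])
qed

text \<open>For Re s > 3 linear growth of the coefficients bounds the k-th term by A k^(-2) on the
  whole vertical line. The partial sums then have the constant majorant \<open>W\<close>, and
  dominated convergence lets sum and integral be exchanged.\<close>

lemma gauss_smooth_dirichlet_series:
  fixes a :: "nat \<Rightarrow> complex"
  assumes f: "\<And>s. s \<in> \<complex>\<^sub>+ \<Longrightarrow> (\<lambda>n. a (Suc n) / of_nat (Suc n) powr s) sums f s"
    and hol: "f holomorphic_on \<complex>\<^sub>+"
    and A: "A \<ge> 0" "\<And>n. norm (a (Suc n)) \<le> A * real (Suc n)"
    and s: "Re s > 3"
  shows "(\<lambda>n. a (Suc n) * exp (- of_real ((d * ln (real (Suc n)))\<^sup>2 / 2)) / of_nat (Suc n) powr s)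
         sums gauss_smooth d f s"
proof -
  have sC: "s \<in> \<complex>\<^sub>+" using s by (simp add: right_half_plane_def)
  define q where "q N t = (\<Sum>k<N. a (Suc k) / of_nat (Suc k) powr (s + \<i> * of_real (d * t)))" for N t
  define W where "W = (\<Sum>k. A * real (Suc k) powr (- 2))"
  have sumW: "summable (\<lambda>k. A * real (Suc k) powr (- 2))"
    using summable_Suc_iff[of "\<lambda>n. real n powr (- 2)"]
    by (intro summable_mult) (simp add: summable_real_powr_iff del: of_nat_Suc)
  have le: "norm (a (Suc k) / of_nat (Suc k) powr (s + \<i> * of_real (d * t))) \<le> A * real (Suc k) powr (- 2)" for k t
  proof -
    have "norm (a (Suc k) / of_nat (Suc k) powr (s + \<i> * of_real (d * t)))
        \<le> A * real (Suc k) / real (Suc k) powr Re s"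
      unfolding norm_divide by (subst norm_of_nat_powr) (use A(2)[of k] in \<open>auto intro!: divide_right_mono\<close>)
    also have "\<dots> = A * real (Suc k) powr (1 - Re s)"
      by (simp add: powr_diff del: of_nat_Suc)
    also have "\<dots> \<le> A * real (Suc k) powr (- 2)"
      using s A(1) by (intro mult_left_mono powr_mono) auto
    finally show ?thesis .
  qed
  have cont: "continuous_on \<complex>\<^sub>+ (\<lambda>s. c / of_nat (Suc k) powr s)" for c :: complex and k
    by (intro continuous_intros) (auto simp del: of_nat_Suc)
  have meas: "(\<lambda>t. a (Suc k) / of_nat (Suc k) powr (s + \<i> * of_real (d * t)))
      \<in> borel_measurable std_normal_distribution" for k
    by (rule vertical_section_measurable[OF cont sC])
  have int: "integrable std_normal_distribution (\<lambda>t. a (Suc k) / of_nat (Suc k) powr (s + \<i> * of_real (d * t)))" for k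
    by (rule std_normal.integrable_const_bound[where B = "A * real (Suc k) powr (- 2)", OF _ meas]) (intro AE_I2 le)
  have "(\<lambda>N. LINT t|std_normal_distribution. q N t) \<longlonglongrightarrow> gauss_smooth d f s"
    unfolding gauss_smooth_def
  proof (rule integral_dominated_convergence[where w = "\<lambda>_. W"])
    show "(\<lambda>t. f (s + \<i> * of_real (d * t))) \<in> borel_measurable std_normal_distribution"
      by (rule vertical_section_measurable[OF holomorphic_on_imp_continuous_on[OF hol] sC])
    show "q N \<in> borel_measurable std_normal_distribution" for N
      unfolding q_def by (intro borel_measurable_sum meas)
    show "AE t in std_normal_distribution. (\<lambda>N. q N t) \<longlonglongrightarrow> f (s + \<i> * of_real (d * t))"
      using f sC unfolding q_def sums_def by (intro AE_I2) (simp only: vertical_shift_right_half_plane)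
    show "AE t in std_normal_distribution. norm (q N t) \<le> W" for N
    proof (rule AE_I2)
      fix t
      have "norm (q N t) \<le> (\<Sum>k<N. A * real (Suc k) powr (- 2))"
        unfolding q_def by (rule sum_norm_le[OF le])
      also have "\<dots> \<le> W" unfolding W_def by (rule sum_le_suminf[OF sumW]) (use A in auto)
      finally show "norm (q N t) \<le> W" .
    qed
  qed auto
  moreover have "(LINT t|std_normal_distribution. q N t)
      = (\<Sum>k<N. a (Suc k) * exp (- of_real ((d * ln (real (Suc k)))\<^sup>2 / 2)) / of_nat (Suc k) powr s)" for N
    unfolding q_def by (subst Bochner_Integration.integral_sum[OF int]) (simp only: integral_powr_std_normal zero_less_Suc)
  ultimately show ?thesis unfolding sums_def by simp
qed

theorem dirichlet_series_uniform_approx: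
  assumes f: "f \<in> H_infty"
    and K: "\<And>s. s \<in> \<complex>\<^sub>+ \<Longrightarrow> norm (deriv f s) \<le> K"
    and e: "e > 0"
  obtains N :: nat and c :: "nat \<Rightarrow> complex"
  where "N \<ge> 1" "\<And>s. s \<in> \<complex>\<^sub>+ \<Longrightarrow> norm ((\<Sum>n=1..N. c n / of_nat n powr s) - f s) < e"
proof -
  note hol = H_infty_holomorphic[OF f]
  obtain a where a: "\<And>s. s \<in> \<complex>\<^sub>+ \<Longrightarrow> (\<lambda>n. a (Suc n) / of_nat (Suc n) powr s) sums f s"
    using f by (auto simp: H_infty_def)
  obtain L where L: "\<And>s. s \<in> \<complex>\<^sub>+ \<Longrightarrow> norm (f s) \<le> L"
    using f by (auto simp: H_infty_def bounded_iff)
  have one: "1 \<in> \<complex>\<^sub>+" by (simp add: right_half_plane_def)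
  have K0: "K \<ge> 0" using K[OF one] norm_ge_zero order_trans by blast
  obtain A where A: "A \<ge> 0" "\<And>n. norm (a (Suc n)) \<le> A * real (Suc n)"
    using dirichlet_coefficients_linear_growth[OF sums_summable[OF a[OF one]]] by blast
  define J where "J = (LINT t|std_normal_distribution. \<bar>t\<bar>)"
  have J: "J \<ge> 0" by (simp add: J_def)
  \<comment> \<open>Chosen so that the smoothing error d K J is at most e/2; the summand 1 keeps the
    denominator positive when K J = 0. The truncation error will be below e/4.\<close>
  define d where "d = e / (2 * (K * J + 1))"
  have KJ: "K * J \<ge> 0" using K0 J by simp
  have d: "d > 0" using e KJ by (simp add: d_def)
  have dKJ: "d * K * J < e / 2 + e / 4"
  proof -
    have "d * (K * J + 1) = e / 2" using KJ by (simp add: d_def field_simps)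
    then have "d * K * J \<le> e / 2" using d by (simp add: algebra_simps)
    then show ?thesis using e by linarith
  qed
  define c where "c n = a n * exp (- of_real ((d * ln (real n))\<^sup>2 / 2))" for n
  define G where "G s = (\<Sum>k. c (Suc k) / of_nat (Suc k) powr s)" for s
  have ul: "uniform_limit \<complex>\<^sub>+ (\<lambda>N s. \<Sum>k<N. c (Suc k) / of_nat (Suc k) powr s) G sequentially"
    unfolding G_def
  proof (rule Weierstrass_m_test)
    show "summable (\<lambda>n. A * (real (Suc n) * exp (- ((d * ln (real (Suc n)))\<^sup>2) / 2)))"
      by (intro summable_mult gaussian_log_weights_summable d)
    fix k s assume s: "s \<in> \<complex>\<^sub>+"
    let ?E = "exp (- ((d * ln (real (Suc k)))\<^sup>2) / 2)"
    have "norm (c (Suc k)) = norm (a (Suc k)) * ?E"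
      unfolding c_def norm_mult by simp
    also have "\<dots> \<le> A * (real (Suc k) * ?E)"
      using mult_right_mono[OF A(2)[of k], of ?E] by (simp add: mult_ac del: of_nat_Suc)
    finally have 1: "norm (c (Suc k)) \<le> A * (real (Suc k) * ?E)" .
    have "1 \<le> real (Suc k) powr Re s"
      using s by (intro ge_one_powr_ge_zero) (auto simp: right_half_plane_def)
    then have "norm (c (Suc k)) / real (Suc k) powr Re s \<le> norm (c (Suc k)) / 1"
      by (intro divide_left_mono) auto
    then have "norm (c (Suc k) / of_nat (Suc k) powr s) \<le> norm (c (Suc k))"
      by (simp only: norm_divide norm_of_nat_powr zero_less_Suc div_by_1)
    with 1 show "norm (c (Suc k) / of_nat (Suc k) powr s) \<le> A * (real (Suc k) * ?E)" by linarith
  qed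
  have G_hol: "G holomorphic_on \<complex>\<^sub>+"
  proof (rule holomorphic_uniform_sequence[OF open_right_half_plane])
    fix N show "(\<lambda>s. \<Sum>k<N. c (Suc k) / of_nat (Suc k) powr s) holomorphic_on \<complex>\<^sub>+"
      by (intro holomorphic_intros) (auto simp del: of_nat_Suc)
  next
    fix x assume "x \<in> \<complex>\<^sub>+"
    then obtain r where "r > 0" "cball x r \<subseteq> \<complex>\<^sub>+"
      using open_right_half_plane open_contains_cball by blast
    then show "\<exists>d>0. cball x d \<subseteq> \<complex>\<^sub>+ \<and>
        uniform_limit (cball x d) (\<lambda>N s. \<Sum>k<N. c (Suc k) / of_nat (Suc k) powr s) G sequentially"
      by (intro exI[of _ r] conjI uniform_limit_on_subset[OF ul])
  qed
  \<comment> \<open>Termwise integration is justified only for Re s > 3. Both sides are holomorphic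
    on the connected half-plane, so equality there extends to all of it.\<close>
  have eq: "gauss_smooth d f s = G s" if "s \<in> \<complex>\<^sub>+" for s
  proof (rule analytic_continuation_open[where s = "{s. Re s > 3}" and s' = "\<complex>\<^sub>+" and f = "gauss_smooth d f" and g = G])
    show "open {s. Re s > 3}" by (rule open_halfspace_Re_gt)
    have "4 \<in> {s. Re s > 3}" by simp
    then show "{s. Re s > 3} \<noteq> {}" by blast
    show "{s. Re s > 3} \<subseteq> \<complex>\<^sub>+" by (auto simp: right_half_plane_def)
    show "connected \<complex>\<^sub>+" by (rule convex_connected[OF convex_right_half_plane])
    show "gauss_smooth d f holomorphic_on \<complex>\<^sub>+" by (rule gauss_smooth_holomorphic[OF hol L K])
    fix z :: complex assume "z \<in> {s. Re s > 3}"
    then show "gauss_smooth d f z = G z"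
      using gauss_smooth_dirichlet_series[OF a hol A, of z d]
      unfolding G_def c_def by (simp only: mem_Collect_eq sums_unique)
  qed (fact open_right_half_plane G_hol that)+
  have "e / 4 > 0" using e by simp
  from uniform_limitD[OF ul this] obtain N where N: "N \<ge> 1"
    "\<forall>s\<in>\<complex>\<^sub>+. dist (\<Sum>k<N. c (Suc k) / of_nat (Suc k) powr s) (G s) < e / 4"
    unfolding eventually_sequentially by (meson le_trans nat_le_linear)
  show ?thesis
  proof (rule that[OF N(1)])
    fix s assume s: "s \<in> \<complex>\<^sub>+"
    have "norm ((\<Sum>k<N. c (Suc k) / of_nat (Suc k) powr s) - G s) < e / 4"
      using N(2) s by (simp add: dist_norm)
    moreover have "norm (G s - f s) \<le> d * K * J"
      unfolding J_def eq[OF s, symmetric]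
      by (rule gauss_smooth_dist_le[OF hol L K s]) (use d in auto)
    moreover have "norm ((\<Sum>k<N. c (Suc k) / of_nat (Suc k) powr s) - f s)
        \<le> norm ((\<Sum>k<N. c (Suc k) / of_nat (Suc k) powr s) - G s) + norm (G s - f s)"
      using norm_triangle_ineq[of "(\<Sum>k<N. c (Suc k) / of_nat (Suc k) powr s) - G s" "G s - f s"] by simp
    ultimately show "norm ((\<Sum>n=1..N. c n / of_nat n powr s) - f s) < e"
      unfolding One_nat_def sum.atLeast1_atMost_eq using dKJ by linarith
  qed
qed

section \<open>Dirichlet polynomials and completely multiplicative characters\<close>

text \<open>The numbers put in place of n^(-s) are an argument of their own. With
  \<open>power_char s\<close> this is evaluation at s; with \<open>prime_char z\<close> it is the
  Bohr lift of the polynomial, evaluated at z.\<close>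

definition dirichlet_value :: "nat \<Rightarrow> (nat \<Rightarrow> complex) \<Rightarrow> (nat \<Rightarrow> complex) \<Rightarrow> complex" where
  "dirichlet_value N a h = (\<Sum>n=1..N. a n * h n)"

text \<open>Complete multiplicativity. The argument 0 is excluded because
  \<open>prime_char z 0\<close> is the empty product 1, for which the equation fails in
  general.\<close>

definition multiplicative_char :: "(nat \<Rightarrow> complex) \<Rightarrow> bool" where
  "multiplicative_char h \<longleftrightarrow> h 1 = 1 \<and> (\<forall>m>0. \<forall>n>0. h (m * n) = h m * h n)"

definition power_char :: "complex \<Rightarrow> nat \<Rightarrow> complex" where
  "power_char s n = of_nat n powr (- s)"

text \<open>Only the values of \<open>z\<close> at the primes matter; at the junk argument 0 the product is empty.\<close>

definition prime_char :: "(nat \<Rightarrow> complex) \<Rightarrow> nat \<Rightarrow> complex" where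
  "prime_char z n = (\<Prod>p\<in>#prime_factorization n. z p)"

lemma multiplicative_prime_char: "multiplicative_char (prime_char z)"
  by (auto simp: multiplicative_char_def prime_char_def prime_factorization_mult)

lemma multiplicative_power_char: "multiplicative_char (power_char s)"
  by (auto simp: multiplicative_char_def power_char_def powr_times_real[symmetric])

text \<open>Induction over the multiset of prime factors. It will be applied to
  \<open>power_char\<close> on the imaginary axis and to the values of a character of the algebra at
  the functions n^(-s).\<close>

lemma prime_char_unique:
  assumes h: "multiplicative_char h" and z: "\<And>p. prime p \<Longrightarrow> h p = z p" and n: "n > 0"
  shows "h n = prime_char z n"
proof -
  have "h (prod_mset M) = prod_mset (image_mset z M)" if "\<forall>p\<in>#M. prime p" for M
    using that
  proof (induction M)
    case (add p M)
    then have "p > 0" "prod_mset M > 0"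
      by (auto simp: prime_gt_0_nat prod_mset_zero_iff intro!: Nat.gr0I)
    with add show ?case using h z by (simp add: multiplicative_char_def)
  qed (use h in \<open>simp add: multiplicative_char_def\<close>)
  from this[of "prime_factorization n"] n show ?thesis
    by (simp add: prime_char_def prod_mset_prime_factorization_nat in_prime_factors_imp_prime)
qed

lemma prime_char_cong:
  assumes "\<And>p. prime p \<Longrightarrow> p \<le> n \<Longrightarrow> z p = w p"
  shows "prime_char z n = prime_char w n"
proof (cases "n = 0")
  case False
  have "image_mset z (prime_factorization n) = image_mset w (prime_factorization n)"
    using assms False by (intro image_mset_cong) (auto simp: in_prime_factors_iff dvd_imp_le)
  then show ?thesis by (simp add: prime_char_def)
qed (simp add: prime_char_def)

lemma dirichlet_value_cong:
  "(\<And>n. 1 \<le> n \<Longrightarrow> n \<le> N \<Longrightarrow> h n = k n) \<Longrightarrow> dirichlet_value N a h = dirichlet_value N a k"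
  unfolding dirichlet_value_def by (intro sum.cong) auto

lemma prime_char_tendsto:
  assumes "\<And>p. prime p \<Longrightarrow> p \<le> n \<Longrightarrow> ((\<lambda>k. z k p) \<longlongrightarrow> w p) F"
  shows "((\<lambda>k. prime_char (z k) n) \<longlongrightarrow> prime_char w n) F"
proof (cases "n = 0")
  case False
  have "((\<lambda>k. \<Prod>p\<in>#M. z k p) \<longlongrightarrow> (\<Prod>p\<in>#M. w p)) F"
    if "\<forall>p\<in>#M. ((\<lambda>k. z k p) \<longlongrightarrow> w p) F" for M
    using that by (induction M) (auto intro!: tendsto_mult)
  moreover have "\<forall>p\<in>#prime_factorization n. ((\<lambda>k. z k p) \<longlongrightarrow> w p) F"
    using assms False by (auto simp: in_prime_factors_iff dvd_imp_le)
  ultimately show ?thesis unfolding prime_char_def by blast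
qed (simp add: prime_char_def)

text \<open>The coefficients are fixed before h, so one and the same polynomial can be estimated on
  the half-plane and then evaluated on the polydisc.\<close>

lemma dirichlet_value_add:
  obtains L c where "\<And>h. dirichlet_value L c h = dirichlet_value N a h + dirichlet_value M b h"
proof
  let ?c = "\<lambda>n. (if n \<le> N then a n else 0) + (if n \<le> M then b n else 0)"
  have ext: "dirichlet_value N a h = (\<Sum>n=1..max N M. (if n \<le> N then a n else 0) * h n)" for N M a h
    unfolding dirichlet_value_def by (rule sum.mono_neutral_cong_left) auto
  show "dirichlet_value (max N M) ?c h = dirichlet_value N a h + dirichlet_value M b h" for h
    unfolding ext[of N a h M] ext[of M b h N]
    by (simp only: dirichlet_value_def sum.distrib[symmetric] distrib_right max.commute)
qed

text \<open>Dirichlet convolution of the coefficients: the double sum is grouped by the product of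
  the two indices. As for sums, the result does not depend on h.\<close>

lemma dirichlet_value_mult:
  obtains L c where "\<And>h. multiplicative_char h \<Longrightarrow>
    dirichlet_value L c h = dirichlet_value N a h * dirichlet_value M b h"
proof
  let ?X = "{1..N} \<times> {1..M}"
  let ?c = "\<lambda>k. \<Sum>x\<in>{x\<in>?X. fst x * snd x = k}. a (fst x) * b (snd x)"
  fix h :: "nat \<Rightarrow> complex" assume h: "multiplicative_char h"
  have "dirichlet_value N a h * dirichlet_value M b h
      = (\<Sum>x\<in>?X. (a (fst x) * b (snd x)) * h (fst x * snd x))"
    unfolding dirichlet_value_def sum_product sum.cartesian_product
    using h by (intro sum.cong) (auto simp: multiplicative_char_def)
  also have "\<dots> = (\<Sum>k\<in>{1..N * M}. \<Sum>x\<in>{x\<in>?X. fst x * snd x = k}. (a (fst x) * b (snd x)) * h (fst x * snd x))"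
    by (rule sum.group[symmetric]) (auto intro!: mult_le_mono simp: Suc_le_eq)
  also have "\<dots> = dirichlet_value (N * M) ?c h"
    unfolding dirichlet_value_def sum_distrib_right by (intro sum.cong) auto
  finally show "dirichlet_value (N * M) ?c h = dirichlet_value N a h * dirichlet_value M b h" by simp
qed

section \<open>The maximum principle on the polydisc\<close>

lemma prod_mset_holomorphic:
  "(\<And>p. p \<in># M \<Longrightarrow> f p holomorphic_on A) \<Longrightarrow> (\<lambda>u. \<Prod>p\<in>#M. f p u) holomorphic_on A"
  by (induction M) (auto intro!: holomorphic_intros)

lemma maximum_on_circle:
  assumes "g holomorphic_on UNIV" "norm (v :: complex) \<le> 1"
  obtains u where "norm u = 1" "norm (g v) \<le> norm (g u)"
proof -
  have cont: "continuous_on A g" for A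
    using assms(1) holomorphic_on_imp_continuous_on continuous_on_subset by blast
  have "sphere (0::complex) 1 \<noteq> {}" by simp
  then obtain u where u: "u \<in> sphere 0 1" "\<And>y. y \<in> sphere 0 1 \<Longrightarrow> norm (g y) \<le> norm (g u)"
    using continuous_attains_sup[OF compact_sphere _ continuous_on_norm[OF cont]] by metis
  have "norm (g v) \<le> norm (g u)"
  proof (rule maximum_modulus_frontier[where S = "cball 0 1" and f = g])
    show "g holomorphic_on interior (cball 0 1)" using assms(1) holomorphic_on_subset by blast
    fix z :: complex assume "z \<in> frontier (cball 0 1)"
    then show "norm (g z) \<le> norm (g u)" using u(2) by simp
  next
    show "continuous_on (closure (cball 0 1)) g" by (rule cont)
    show "v \<in> cball 0 1" using assms(2) by simp
  qed simp
  with u(1) that show ?thesis by simp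
qed

text \<open>The value is holomorphic in each coordinate separately, so the maximum principle moves
  one coordinate at a time to the unit circle without lowering the modulus and without touching the
  others. Finitely many moves suffice, since only primes up to N occur; the coordinates beyond N are
  set to 1.\<close>

lemma dirichlet_value_maximum_on_torus:
  assumes z: "\<And>p. norm (z p) \<le> 1"
  obtains w where "\<And>p. norm (w p) = 1"
    "norm (dirichlet_value N a (prime_char z)) \<le> norm (dirichlet_value N a (prime_char w))"
proof -
  have "\<exists>w. (\<forall>p. norm (w p) \<le> 1) \<and> (\<forall>p\<in>S. norm (w p) = 1) \<and>
      norm (dirichlet_value N a (prime_char z)) \<le> norm (dirichlet_value N a (prime_char w))"
    if "finite S" for S
    using that
  proof induction
    case empty
    then show ?case using z by auto
  next
    case (insert q S)
    then obtain w where w: "\<And>p. norm (w p) \<le> 1" "\<And>p. p \<in> S \<Longrightarrow> norm (w p) = 1"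
      "norm (dirichlet_value N a (prime_char z)) \<le> norm (dirichlet_value N a (prime_char w))"
      by blast
    define g where "g u = dirichlet_value N a (prime_char (w(q := u)))" for u
    have "g holomorphic_on UNIV"
      unfolding g_def dirichlet_value_def prime_char_def fun_upd_apply
      by (intro holomorphic_intros prod_mset_holomorphic) (rename_tac n p, case_tac "p = q", auto)
    then obtain u where u: "norm u = 1" "norm (g (w q)) \<le> norm (g u)"
      using maximum_on_circle w(1) by blast
    have "norm (dirichlet_value N a (prime_char z)) \<le> norm (g u)"
      using w(3) u(2) by (simp add: g_def)
    then show ?case
      using u(1) w(1,2) unfolding g_def by (metis fun_upd_other fun_upd_same insert_iff order_refl)
  qed
  from this[of "{..N}"] obtain w where w: "\<And>p. p \<le> N \<Longrightarrow> norm (w p) = 1"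
    "norm (dirichlet_value N a (prime_char z)) \<le> norm (dirichlet_value N a (prime_char w))"
    by auto
  define w' where "w' p = (if p \<le> N then w p else 1)" for p
  have "dirichlet_value N a (prime_char w) = dirichlet_value N a (prime_char w')"
    by (intro dirichlet_value_cong prime_char_cong) (simp add: w'_def)
  with w that[of w'] show ?thesis by (simp add: w'_def)
qed

section \<open>Kronecker's theorem for the logarithms of the primes\<close>

lemma ln_primes_independent:
  fixes c :: "nat \<Rightarrow> int"
  assumes fin: "finite P" and P: "\<And>p. p \<in> P \<Longrightarrow> prime p"
    and eq: "(\<Sum>p\<in>P. of_int (c p) * ln (real p)) = 0" and q: "q \<in> P"
  shows "c q = 0"
proof -
  \<comment> \<open>Since \<open>nat\<close> sends negative integers to 0, \<open>A c\<close>
    collects the positive exponents and the same product for -c the negative ones. The vanishing sum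
    says that these two natural numbers have equal logarithms, so they agree, and at each prime in P
    one of the two exponents is 0.\<close>
  define A where "A g = (\<Prod>p\<in>P. p ^ nat (g p))" for g :: "nat \<Rightarrow> int"
  have pos: "real p > 0" if "p \<in> P" for p using P[OF that] prime_gt_0_nat by simp
  have ln_A: "ln (real (A g)) = (\<Sum>p\<in>P. real (nat (g p)) * ln (real p))" for g
    unfolding A_def of_nat_prod using pos
    by (subst ln_prod) (auto simp: fin ln_realpow)
  have "ln (real (A c)) - ln (real (A (\<lambda>p. - c p))) = (\<Sum>p\<in>P. of_int (c p) * ln (real p))"
    unfolding ln_A sum_subtractf[symmetric] left_diff_distrib[symmetric]
    by (intro sum.cong refl arg_cong2[where f = "(*)"]) auto
  then have "ln (real (A c)) = ln (real (A (\<lambda>p. - c p)))" using eq by simp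
  moreover have "A g > 0" for g unfolding A_def using pos by (intro prod_pos) auto
  ultimately have "A c = A (\<lambda>p. - c p)" by simp
  then have "multiplicity q (A c) = multiplicity q (A (\<lambda>p. - c p))" by simp
  then have "nat (c q) = nat (- c q)"
    unfolding A_def by (subst (asm) (1 2) multiplicity_prod_prime_powers) (use fin P q in auto)
  then show ?thesis by linarith
qed

text \<open>The factor 1/(2 pi) measures t ln p in full turns, so that the integers
  \<open>h p\<close> will disappear once the exponential is taken.\<close>

lemma kronecker_primes:
  assumes e: "e > 0"
  obtains t h where "\<And>p. prime p \<Longrightarrow> p \<le> N \<Longrightarrow> \<bar>t * (ln (real p) / (2 * pi)) - of_int (h p) - \<alpha> p\<bar> < e"
proof -
  define P where "P = {p. prime p \<and> p \<le> N}"
  have fin: "finite P" unfolding P_def by (rule finite_subset[of _ "{..N}"]) auto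
  obtain f where f: "bij_betw f {0..<card P} P" using ex_bij_betw_nat_finite[OF fin] by blast
  define n where "n = card P"
  have f: "bij_betw f {..<n} P" using f by (simp add: n_def atLeast0LessThan)
  define l where "l p = ln (real p) / (2 * pi)" for p :: nat
  define \<theta> where "\<theta> i = l (f i)" for i
  \<comment> \<open>Independence speaks of the set of frequencies; injectivity excludes that two
    indices share one frequency.\<close>
  have inj_l: "inj_on l P"
    by (intro inj_onI) (auto simp: l_def P_def prime_gt_0_nat)
  have img: "\<theta> ` {..<n} = l ` P"
    using f unfolding \<theta>_def bij_betw_def by (metis image_image)
  have inj: "inj_on \<theta> {..<n}"
    using comp_inj_on[of f "{..<n}" l] f inj_l unfolding bij_betw_def \<theta>_def[abs_def] comp_def by simp
  \<comment> \<open>The reals as a module over the integers, so that \<open>M.independent\<close> is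
    independence over the integers.\<close>
  interpret M: Modules.module "\<lambda>r. (*) (real_of_int r)"
    by (simp add: Modules.module.intro distrib_left mult.commute)
  have "M.independent (\<theta> ` {..<n})"
  proof -
    have "u v = 0" if "(\<Sum>v\<in>l ` P. real_of_int (u v) * v) = 0" "v \<in> l ` P" for u v
    proof -
      from that(2) obtain q where q: "q \<in> P" "v = l q" by blast
      have "(\<Sum>p\<in>P. real_of_int (u (l p)) * ln (real p)) / (2 * pi) = 0"
        using that(1) unfolding sum.reindex[OF inj_l] by (simp add: l_def sum_divide_distrib)
      then have "(\<Sum>p\<in>P. real_of_int (u (l p)) * ln (real p)) = 0" by simp
      from ln_primes_independent[OF fin _ this q(1)] q show ?thesis by (simp add: P_def)
    qed
    then show ?thesis unfolding img by (subst M.dependent_finite) (use fin in auto)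
  qed
  from Kronecker_thm_1[OF this inj e, of "\<lambda>i. \<alpha> (f i)"] obtain t h
    where th: "\<And>i. i < n \<Longrightarrow> \<bar>t * \<theta> i - of_int (h i) - \<alpha> (f i)\<bar> < e" by blast
  show ?thesis
  proof (rule that[of t "\<lambda>p. h (inv_into {..<n} f p)"])
    fix p assume "prime p" "p \<le> N"
    then have "p \<in> P" by (simp add: P_def)
    then have "inv_into {..<n} f p < n" "f (inv_into {..<n} f p) = p"
      using f by (auto simp: bij_betw_def inv_into_into f_inv_into_f simp flip: lessThan_iff)
    from th[OF this(1)] this(2)
    show "\<bar>t * (ln (real p) / (2 * pi)) - of_int (h (inv_into {..<n} f p)) - \<alpha> p\<bar> < e"
      by (simp add: \<theta>_def l_def)
  qed
qed

text \<open>Every point of the torus is approximated, at all primes up to N simultaneously, by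
  points p^(-it) coming from the imaginary axis.\<close>

lemma power_char_imaginary_dense:
  assumes w: "\<And>p. norm (w p) = 1"
  obtains t :: "nat \<Rightarrow> real"
  where "\<And>p. prime p \<Longrightarrow> p \<le> N \<Longrightarrow> (\<lambda>k. power_char (\<i> * of_real (t k)) p) \<longlonglongrightarrow> w p"
proof -
  \<comment> \<open>The angle of \<open>w p\<close> in full turns; the sign compensates the one in
    p^(-it) = cis (- t ln p).\<close>
  define \<alpha> where "\<alpha> p = - Arg (w p) / (2 * pi)" for p
  have "\<exists>t h. \<forall>p. prime p \<longrightarrow> p \<le> N \<longrightarrow>
      \<bar>t * (ln (real p) / (2 * pi)) - of_int (h p) - \<alpha> p\<bar> < inverse (real (Suc k))" for k
    by (rule kronecker_primes[of "inverse (real (Suc k))" N \<alpha>]) auto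
  then obtain t h where th: "\<And>k p. prime p \<Longrightarrow> p \<le> N \<Longrightarrow>
      \<bar>t k * (ln (real p) / (2 * pi)) - of_int (h k p) - \<alpha> p\<bar> < inverse (real (Suc k))"
    by metis
  show ?thesis
  proof (rule that[of t])
    fix p assume p: "prime p" "p \<le> N"
    define x where "x k = t k * (ln (real p) / (2 * pi)) - of_int (h k p)" for k
    have "(\<lambda>k. x k - \<alpha> p) \<longlonglongrightarrow> 0"
      by (rule Lim_null_comparison[OF _ LIMSEQ_inverse_real_of_nat])
         (use th[OF p] in \<open>auto simp: x_def less_imp_le\<close>)
    then have "x \<longlonglongrightarrow> \<alpha> p" by (simp add: LIM_zero_iff)
    then have "(\<lambda>k. cis (- (2 * pi) * x k)) \<longlonglongrightarrow> cis (- (2 * pi) * \<alpha> p)"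
      unfolding cis_conv_exp by (intro tendsto_intros)
    moreover have "cis (- (2 * pi) * \<alpha> p) = w p"
      using cis_Arg[of "w p"] w[of p] by (cases "w p = 0") (simp_all add: \<alpha>_def sgn_eq)
    moreover have "cis (- (2 * pi) * x k) = power_char (\<i> * of_real (t k)) p" for k
    proof -
      have "- (2 * pi) * x k = - (t k * ln (real p)) + 2 * pi * of_int (h k p)"
        by (simp add: x_def algebra_simps)
      then have "cis (- (2 * pi) * x k) = cis (- (t k * ln (real p))) * cis (2 * pi * of_int (h k p))"
        by (simp only: cis_mult)
      also have "cis (2 * pi * of_int (h k p)) = 1" by (rule cis_multiple_2pi) simp
      finally show ?thesis
        using p prime_gt_0_nat[of p] by (simp add: power_char_def powr_def cis_conv_exp Ln_of_nat mult_ac)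
    qed
    ultimately show "(\<lambda>k. power_char (\<i> * of_real (t k)) p) \<longlonglongrightarrow> w p" by simp
  qed
qed

lemma power_char_tendsto:
  assumes "n > 0" "(f \<longlongrightarrow> s) F"
  shows "((\<lambda>x. power_char (f x) n) \<longlongrightarrow> power_char s n) F"
  unfolding power_char_def by (rule tendsto_powr_complex) (use assms in \<open>auto intro!: tendsto_intros\<close>)

theorem dirichlet_value_prime_char_le:
  assumes M: "\<And>s. s \<in> \<complex>\<^sub>+ \<Longrightarrow> norm (dirichlet_value N a (power_char s)) \<le> M"
    and z: "\<And>p. prime p \<Longrightarrow> norm (z p) \<le> 1"
  shows "norm (dirichlet_value N a (prime_char z)) \<le> M"
proof -
  \<comment> \<open>Maximise over the torus, then approximate the point of the torus by \<open>p \<mapsto> p powr (-\<i>t)\<close>.\<close>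
  define z' where "z' p = (if prime p then z p else 0)" for p
  have z': "norm (z' p) \<le> 1" for p using z[of p] by (simp add: z'_def)
  obtain w where w: "\<And>p. norm (w p) = 1"
    "norm (dirichlet_value N a (prime_char z')) \<le> norm (dirichlet_value N a (prime_char w))"
    by (rule dirichlet_value_maximum_on_torus[of z' N a, OF z']) (rule that; assumption)
  obtain t where t: "\<And>p. prime p \<Longrightarrow> p \<le> N \<Longrightarrow> (\<lambda>k. power_char (\<i> * of_real (t k)) p) \<longlonglongrightarrow> w p"
    by (rule power_char_imaginary_dense[of w N, OF w(1)]) (rule that; assumption)
  \<comment> \<open>The hypothesis covers only the open half-plane; the boundary line is reached
    from points with real part 1/(k+1).\<close>
  have le: "norm (dirichlet_value N a (power_char (\<i> * of_real \<tau>))) \<le> M" for \<tau>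
  proof (rule tendsto_upperbound)
    have "(\<lambda>k. \<i> * of_real \<tau> + of_real (inverse (real (Suc k)))) \<longlonglongrightarrow> \<i> * of_real \<tau> + of_real 0"
      by (intro tendsto_intros LIMSEQ_inverse_real_of_nat)
    then show "(\<lambda>k. norm (dirichlet_value N a (power_char (\<i> * of_real \<tau> + of_real (inverse (real (Suc k)))))))
        \<longlonglongrightarrow> norm (dirichlet_value N a (power_char (\<i> * of_real \<tau>)))"
      unfolding dirichlet_value_def by (intro tendsto_intros power_char_tendsto) auto
    show "\<forall>\<^sub>F k in sequentially. norm (dirichlet_value N a (power_char (\<i> * of_real \<tau> + of_real (inverse (real (Suc k)))))) \<le> M"
      by (intro always_eventually allI M) (simp add: right_half_plane_def)
  qed auto
  have "(\<lambda>k. dirichlet_value N a (power_char (\<i> * of_real (t k)))) \<longlonglongrightarrow> dirichlet_value N a (prime_char w)"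
    unfolding dirichlet_value_def
  proof (intro tendsto_intros)
    fix n assume n: "n \<in> {1..N}"
    have "(\<lambda>k. prime_char (power_char (\<i> * of_real (t k))) n) \<longlonglongrightarrow> prime_char w n"
      by (rule prime_char_tendsto) (use t n in auto)
    then show "(\<lambda>k. power_char (\<i> * of_real (t k)) n) \<longlonglongrightarrow> prime_char w n"
      using prime_char_unique[OF multiplicative_power_char refl, of n] n by simp
  qed
  from tendsto_upperbound[OF tendsto_norm[OF this], of M]
  have "norm (dirichlet_value N a (prime_char w)) \<le> M" using le by simp
  \<comment> \<open>The torus lemma asks for a bound on every coordinate, the hypothesis gives it at
    primes only. Setting the others to 0 changes nothing, as \<open>prime_char\<close> reads prime
    coordinates alone.\<close>
  moreover have "dirichlet_value N a (prime_char z') = dirichlet_value N a (prime_char z)"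
    by (intro dirichlet_value_cong prime_char_cong) (simp add: z'_def)
  ultimately show ?thesis using w(2) by simp
qed

section \<open>Extending characters to uniform limits of Dirichlet polynomials\<close>

text \<open>Coordinates are indexed by all naturals, but only those at primes are constrained. An
  enumeration of the primes will relate this set to the polydisc over all naturals.\<close>

definition polydisc :: "(nat \<Rightarrow> complex) set" where
  "polydisc = {z. \<forall>p. prime p \<longrightarrow> norm (z p) \<le> 1}"

text \<open>The inequality is not strict, so that e = 0 is allowed and expresses equality on the
  half-plane.\<close>

definition dirichlet_approx :: "(complex \<Rightarrow> complex) \<Rightarrow> real \<Rightarrow> nat \<Rightarrow> (nat \<Rightarrow> complex) \<Rightarrow> bool" where
  "dirichlet_approx f e N a \<longleftrightarrow> (\<forall>s\<in>\<complex>\<^sub>+. norm (dirichlet_value N a (power_char s) - f s) \<le> e)"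

definition dirichlet_approximable :: "(complex \<Rightarrow> complex) \<Rightarrow> bool" where
  "dirichlet_approximable f \<longleftrightarrow> (\<forall>e>0. \<exists>N a. dirichlet_approx f e N a)"

text \<open>Meaningful only for \<open>z \<in> polydisc\<close> and \<open>f\<close> a uniform limit of Dirichlet polynomials.\<close>

definition char_ext :: "(nat \<Rightarrow> complex) \<Rightarrow> (complex \<Rightarrow> complex) \<Rightarrow> complex" where
  "char_ext z f = (THE c. \<forall>e N a. dirichlet_approx f e N a \<longrightarrow>
     norm (dirichlet_value N a (prime_char z) - c) \<le> e)"

lemma dirichlet_approxD:
  "dirichlet_approx f e N a \<Longrightarrow> s \<in> \<complex>\<^sub>+ \<Longrightarrow> norm (dirichlet_value N a (power_char s) - f s) \<le> e"
  by (simp add: dirichlet_approx_def)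

text \<open>The difference of the two polynomials is at most e + e' on the half-plane, and
  \<open>dirichlet_value_prime_char_le\<close> carries this bound over to the polydisc.\<close>

lemma dirichlet_approx_prime_char_dist:
  assumes z: "z \<in> polydisc" and "dirichlet_approx f e N a" "dirichlet_approx f e' M b"
  shows "norm (dirichlet_value N a (prime_char z) - dirichlet_value M b (prime_char z)) \<le> e + e'"
proof -
  obtain L c where Lc: "\<And>h. dirichlet_value L c h = dirichlet_value N a h + dirichlet_value M (\<lambda>n. - b n) h"
    by (rule dirichlet_value_add[of N a M "\<lambda>n. - b n"]) (rule that; assumption)
  have "dirichlet_value M (\<lambda>n. - b n) h = - dirichlet_value M b h" for h
    by (simp add: dirichlet_value_def sum_negf)
  with Lc have c: "dirichlet_value L c h = dirichlet_value N a h - dirichlet_value M b h" for h by simp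
  have "norm (dirichlet_value L c (prime_char z)) \<le> e + e'"
  proof (rule dirichlet_value_prime_char_le)
    fix s assume s: "s \<in> \<complex>\<^sub>+"
    show "norm (dirichlet_value L c (power_char s)) \<le> e + e'"
      unfolding c using dirichlet_approxD[OF assms(2) s] dirichlet_approxD[OF assms(3) s]
      by (smt (verit) norm_triangle_ineq4 diff_diff_eq2 add_diff_cancel_right' diff_add_cancel)
  qed (use z in \<open>auto simp: polydisc_def\<close>)
  then show ?thesis unfolding c .
qed

lemma dirichlet_approximable_sequence:
  assumes "dirichlet_approximable f"
  obtains N a where "\<And>k. dirichlet_approx f (inverse (real (Suc k))) (N k) (a k)"
proof -
  have "\<forall>k. \<exists>N a. dirichlet_approx f (inverse (real (Suc k))) N a"
    using assms unfolding dirichlet_approximable_def by simp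
  then show ?thesis using that by metis
qed

text \<open>Shows that the description in \<open>char_ext\<close> has exactly one solution. Values
  at z of approximants with errors 1/(k+1) form a Cauchy sequence; its limit meets the condition for
  every approximation, and these errors tending to 0 leave no other candidate. Quantifying over all
  approximations makes \<open>char_ext\<close> independent of a chosen sequence.\<close>

lemma char_ext_approx:
  assumes z: "z \<in> polydisc" and f: "dirichlet_approximable f" and P: "dirichlet_approx f e N a"
  shows "norm (dirichlet_value N a (prime_char z) - char_ext z f) \<le> e"
proof -
  let ?Q = "\<lambda>c. \<forall>e N a. dirichlet_approx f e N a \<longrightarrow> norm (dirichlet_value N a (prime_char z) - c) \<le> e"
  obtain N' a' where P': "\<And>k. dirichlet_approx f (inverse (real (Suc k))) (N' k) (a' k)"
    by (rule dirichlet_approximable_sequence[OF f]) (rule that; assumption)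
  define c where "c k = dirichlet_value (N' k) (a' k) (prime_char z)" for k
  have "Cauchy c"
  proof (rule metric_CauchyI)
    fix r :: real assume "r > 0"
    then obtain K where K: "inverse (real (Suc K)) < r / 2"
      using reals_Archimedean[of "r / 2"] by auto
    have le: "inverse (real (Suc k)) < r / 2" if "k \<ge> K" for k
      using K that by (smt (verit) le_imp_inverse_le of_nat_le_iff of_nat_0_less_iff zero_less_Suc Suc_le_mono)
    have "dist (c m) (c n) < r" if "m \<ge> K" "n \<ge> K" for m n
      using dirichlet_approx_prime_char_dist[OF z P'[of m] P'[of n]] le[OF that(1)] le[OF that(2)]
      unfolding dist_norm c_def by linarith
    then show "\<exists>K. \<forall>m\<ge>K. \<forall>n\<ge>K. dist (c m) (c n) < r" by blast
  qed
  then obtain l where l: "c \<longlonglongrightarrow> l" using Cauchy_convergent convergent_def by blast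
  have Q: "?Q l"
  proof (intro allI impI)
    fix e N a assume P: "dirichlet_approx f e N a"
    have "(\<lambda>k. norm (dirichlet_value N a (prime_char z) - c k)) \<longlonglongrightarrow> norm (dirichlet_value N a (prime_char z) - l)"
      by (intro tendsto_intros l)
    moreover have "(\<lambda>k. e + inverse (real (Suc k))) \<longlonglongrightarrow> e + 0"
      by (intro tendsto_intros LIMSEQ_inverse_real_of_nat)
    ultimately have "norm (dirichlet_value N a (prime_char z) - l) \<le> e + 0"
      by (rule LIMSEQ_le) (use dirichlet_approx_prime_char_dist[OF z P P'] in \<open>auto simp: c_def\<close>)
    then show "norm (dirichlet_value N a (prime_char z) - l) \<le> e" by simp
  qed
  have uniq: "x = l" if "?Q x" for x
  proof -
    have "norm (c k - x) \<le> inverse (real (Suc k))" for k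
      using that P'[of k] unfolding c_def by blast
    then have "(\<lambda>k. c k - x) \<longlonglongrightarrow> 0"
      by (intro Lim_null_comparison[OF _ LIMSEQ_inverse_real_of_nat] always_eventually allI)
    then have "c \<longlonglongrightarrow> x" by (simp add: LIM_zero_iff)
    then show "x = l" using l LIMSEQ_unique by blast
  qed
  have "?Q (char_ext z f)" unfolding char_ext_def by (rule theI[of ?Q, OF Q uniq])
  then show ?thesis using P by blast
qed

lemma char_ext_tendsto:
  assumes "z \<in> polydisc" "dirichlet_approximable f"
    and "\<And>k. dirichlet_approx f (e k) (N k) (a k)" "e \<longlonglongrightarrow> 0"
  shows "(\<lambda>k. dirichlet_value (N k) (a k) (prime_char z)) \<longlonglongrightarrow> char_ext z f"
proof -
  have "(\<lambda>k. dirichlet_value (N k) (a k) (prime_char z) - char_ext z f) \<longlonglongrightarrow> 0"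
    by (rule Lim_null_comparison[OF _ assms(4)]) (intro always_eventually allI char_ext_approx assms)
  then show ?thesis by (simp add: LIM_zero_iff)
qed

lemma dirichlet_approx_mono: "dirichlet_approx f e N a \<Longrightarrow> e \<le> e' \<Longrightarrow> dirichlet_approx f e' N a"
  unfolding dirichlet_approx_def by (meson order_trans)

lemma dirichlet_approximableI_sequence:
  assumes "\<And>k. dirichlet_approx f (e k) (N k) (a k)" "e \<longlonglongrightarrow> 0"
  shows "dirichlet_approximable f"
  unfolding dirichlet_approximable_def
proof (intro allI impI)
  fix d :: real assume "d > 0"
  then have "\<forall>\<^sub>F k in sequentially. e k < d" using assms(2) by (rule order_tendstoD(2)[rotated])
  then obtain k where "e k < d" unfolding eventually_sequentially by blast
  then show "\<exists>N a. dirichlet_approx f d N a" using assms(1) dirichlet_approx_mono less_imp_le by blast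
qed

lemma char_ext_value:
  assumes z: "z \<in> polydisc" and f: "\<And>s. s \<in> \<complex>\<^sub>+ \<Longrightarrow> f s = dirichlet_value N a (power_char s)"
  shows "char_ext z f = dirichlet_value N a (prime_char z)"
proof -
  have P: "dirichlet_approx f 0 N a" by (simp add: dirichlet_approx_def f)
  then have "dirichlet_approximable f"
    by (intro dirichlet_approximableI_sequence[of f "\<lambda>_. 0" "\<lambda>_. N" "\<lambda>_. a"]) auto
  from char_ext_approx[OF z this P] show ?thesis by simp
qed

lemma char_ext_norm_le:
  assumes z: "z \<in> polydisc" and f: "dirichlet_approximable f"
    and M: "\<And>s. s \<in> \<complex>\<^sub>+ \<Longrightarrow> norm (f s) \<le> M"
  shows "norm (char_ext z f) \<le> M"
proof -
  obtain N a where P: "\<And>k. dirichlet_approx f (inverse (real (Suc k))) (N k) (a k)"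
    by (rule dirichlet_approximable_sequence[OF f]) (rule that; assumption)
  have "(\<lambda>k. norm (dirichlet_value (N k) (a k) (prime_char z))) \<longlonglongrightarrow> norm (char_ext z f)"
    by (intro tendsto_norm char_ext_tendsto[OF z f P LIMSEQ_inverse_real_of_nat])
  moreover have "(\<lambda>k. M + inverse (real (Suc k))) \<longlonglongrightarrow> M + 0"
    by (intro tendsto_intros LIMSEQ_inverse_real_of_nat)
  moreover have "norm (dirichlet_value (N k) (a k) (prime_char z)) \<le> M + inverse (real (Suc k))" for k
  proof (rule dirichlet_value_prime_char_le)
    fix s assume s: "s \<in> \<complex>\<^sub>+"
    have "norm (dirichlet_value (N k) (a k) (power_char s))
        \<le> norm (f s) + norm (dirichlet_value (N k) (a k) (power_char s) - f s)"
      by (metis add.commute diff_add_cancel norm_triangle_ineq)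
    then show "norm (dirichlet_value (N k) (a k) (power_char s)) \<le> M + inverse (real (Suc k))"
      using M[OF s] dirichlet_approxD[OF P[of k] s] by linarith
  qed (use z in \<open>auto simp: polydisc_def\<close>)
  ultimately have "norm (char_ext z f) \<le> M + 0" by (intro LIMSEQ_le) auto
  then show ?thesis by simp
qed

lemma char_ext_add:
  assumes z: "z \<in> polydisc" and f: "dirichlet_approximable f" and g: "dirichlet_approximable g"
    and h: "\<And>s. s \<in> \<complex>\<^sub>+ \<Longrightarrow> h s = f s + g s"
  shows "char_ext z h = char_ext z f + char_ext z g"
proof -
  obtain N a where P: "\<And>k. dirichlet_approx f (inverse (real (Suc k))) (N k) (a k)"
    by (rule dirichlet_approximable_sequence[OF f]) (rule that; assumption)
  obtain M b where Q: "\<And>k. dirichlet_approx g (inverse (real (Suc k))) (M k) (b k)"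
    by (rule dirichlet_approximable_sequence[OF g]) (rule that; assumption)
  have "\<forall>k. \<exists>L c. \<forall>h. dirichlet_value L c h = dirichlet_value (N k) (a k) h + dirichlet_value (M k) (b k) h"
    using dirichlet_value_add by metis
  then obtain L c where Lc: "\<And>k h. dirichlet_value (L k) (c k) h
      = dirichlet_value (N k) (a k) h + dirichlet_value (M k) (b k) h" by metis
  let ?e = "\<lambda>k. inverse (real (Suc k)) + inverse (real (Suc k))"
  have R: "dirichlet_approx h (?e k) (L k) (c k)" for k
    unfolding dirichlet_approx_def
  proof
    fix s assume s: "s \<in> \<complex>\<^sub>+"
    show "norm (dirichlet_value (L k) (c k) (power_char s) - h s) \<le> ?e k"
      unfolding Lc h[OF s] add_diff_add
      by (intro norm_triangle_le add_mono dirichlet_approxD P Q s)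
  qed
  have "?e \<longlonglongrightarrow> 0 + 0" by (intro tendsto_intros LIMSEQ_inverse_real_of_nat)
  then have e: "?e \<longlonglongrightarrow> 0" by simp
  have "(\<lambda>k. dirichlet_value (L k) (c k) (prime_char z)) \<longlonglongrightarrow> char_ext z h"
    by (rule char_ext_tendsto[OF z dirichlet_approximableI_sequence[OF R e] R e])
  moreover have "(\<lambda>k. dirichlet_value (L k) (c k) (prime_char z)) \<longlonglongrightarrow> char_ext z f + char_ext z g"
    unfolding Lc
    by (intro tendsto_add char_ext_tendsto[OF z f P LIMSEQ_inverse_real_of_nat]
        char_ext_tendsto[OF z g Q LIMSEQ_inverse_real_of_nat])
  ultimately show ?thesis by (rule LIMSEQ_unique)
qed

lemma char_ext_mult:
  assumes z: "z \<in> polydisc" and f: "dirichlet_approximable f" and g: "dirichlet_approximable g"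
    and bdf: "\<And>s. s \<in> \<complex>\<^sub>+ \<Longrightarrow> norm (f s) \<le> A" and bdg: "\<And>s. s \<in> \<complex>\<^sub>+ \<Longrightarrow> norm (g s) \<le> B"
    and h: "\<And>s. s \<in> \<complex>\<^sub>+ \<Longrightarrow> h s = f s * g s"
  shows "char_ext z h = char_ext z f * char_ext z g"
proof -
  obtain N a where P: "\<And>k. dirichlet_approx f (inverse (real (Suc k))) (N k) (a k)"
    by (rule dirichlet_approximable_sequence[OF f]) (rule that; assumption)
  obtain M b where Q: "\<And>k. dirichlet_approx g (inverse (real (Suc k))) (M k) (b k)"
    by (rule dirichlet_approximable_sequence[OF g]) (rule that; assumption)
  have "\<forall>k. \<exists>L c. \<forall>h. multiplicative_char h \<longrightarrow> dirichlet_value L c h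
      = dirichlet_value (N k) (a k) h * dirichlet_value (M k) (b k) h"
    using dirichlet_value_mult by metis
  then obtain L c where Lc: "\<And>k h. multiplicative_char h \<Longrightarrow> dirichlet_value (L k) (c k) h
      = dirichlet_value (N k) (a k) h * dirichlet_value (M k) (b k) h" by metis
  let ?d = "\<lambda>k. inverse (real (Suc k))"
  \<comment> \<open>Error of the product F G as approximation of f g, from F G - f g = (F - f) G + f
    (G - g) and |G| <= B + \<open>?d k\<close>.\<close>
  let ?e = "\<lambda>k. ?d k * (B + ?d k) + A * ?d k"
  have R: "dirichlet_approx h (?e k) (L k) (c k)" for k
    unfolding dirichlet_approx_def
  proof
    fix s assume s: "s \<in> \<complex>\<^sub>+"
    let ?F = "dirichlet_value (N k) (a k) (power_char s)" and ?G = "dirichlet_value (M k) (b k) (power_char s)"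
    have F: "norm (?F - f s) \<le> ?d k" and G: "norm (?G - g s) \<le> ?d k"
      by (intro dirichlet_approxD P Q s)+
    have G': "norm ?G \<le> B + ?d k"
      using norm_triangle_ineq[of "g s" "?G - g s"] bdg[OF s] G by simp
    have A0: "A \<ge> 0" using bdf[OF s] norm_ge_zero order_trans by blast
    have "norm (?F * ?G - f s * g s) = norm ((?F - f s) * ?G + f s * (?G - g s))"
      by (simp add: algebra_simps)
    also have "\<dots> \<le> norm (?F - f s) * norm ?G + norm (f s) * norm (?G - g s)"
      by (rule norm_triangle_le) (simp add: norm_mult)
    also have "\<dots> \<le> ?e k"
      by (intro add_mono mult_mono F G G' bdf[OF s] A0) auto
    finally show "norm (dirichlet_value (L k) (c k) (power_char s) - h s) \<le> ?e k"
      unfolding Lc[OF multiplicative_power_char] h[OF s] .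
  qed
  have "?e \<longlonglongrightarrow> 0 * (B + 0) + A * 0" by (intro tendsto_intros LIMSEQ_inverse_real_of_nat)
  then have e: "?e \<longlonglongrightarrow> 0" by simp
  have "(\<lambda>k. dirichlet_value (L k) (c k) (prime_char z)) \<longlonglongrightarrow> char_ext z h"
    by (rule char_ext_tendsto[OF z dirichlet_approximableI_sequence[OF R e] R e])
  moreover have "(\<lambda>k. dirichlet_value (L k) (c k) (prime_char z)) \<longlonglongrightarrow> char_ext z f * char_ext z g"
    unfolding Lc[OF multiplicative_prime_char]
    by (intro tendsto_mult char_ext_tendsto[OF z f P LIMSEQ_inverse_real_of_nat]
        char_ext_tendsto[OF z g Q LIMSEQ_inverse_real_of_nat])
  ultimately show ?thesis by (rule LIMSEQ_unique)
qed

lemma bounded_deriv_imp_dirichlet_approximable: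
  assumes "f \<in> H_infty" "\<And>s. s \<in> \<complex>\<^sub>+ \<Longrightarrow> norm (deriv f s) \<le> K"
  shows "dirichlet_approximable f"
  unfolding dirichlet_approximable_def
proof (intro allI impI)
  fix e :: real assume "e > 0"
  from dirichlet_series_uniform_approx[OF assms this] obtain N c
    where "\<And>s. s \<in> \<complex>\<^sub>+ \<Longrightarrow> norm ((\<Sum>n=1..N. c n / of_nat n powr s) - f s) < e" by metis
  then show "\<exists>N a. dirichlet_approx f e N a"
    unfolding dirichlet_approx_def dirichlet_value_def power_char_def powr_minus divide_inverse
    using less_imp_le by blast
qed

section \<open>Algebras defined by derivatives\<close>

lemma nth_deriv_0: "f \<in> extensional \<complex>\<^sub>+ \<Longrightarrow> nth_deriv 0 f = f"
  by (simp add: nth_deriv_def extensional_restrict)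

lemma nth_deriv_cong:
  assumes "\<And>s. s \<in> \<complex>\<^sub>+ \<Longrightarrow> f s = g s"
  shows "nth_deriv l f = nth_deriv l g"
  unfolding nth_deriv_def
proof (rule restrict_ext)
  fix s assume s: "s \<in> \<complex>\<^sub>+"
  have "\<forall>\<^sub>F x in nhds s. f x = g x"
    using eventually_nhds_in_open[OF open_right_half_plane s] by eventually_elim (rule assms)
  then show "(deriv ^^ l) f s = (deriv ^^ l) g s" by (rule higher_deriv_cong_ev) simp
qed

lemma nth_deriv_restrict [simp]: "nth_deriv l (restrict f \<complex>\<^sub>+) = nth_deriv l f"
  by (rule nth_deriv_cong) simp

lemma nth_deriv_add: "nth_deriv l (nth_deriv k f) = nth_deriv (l + k) f"
proof -
  have "nth_deriv l (nth_deriv k f) = nth_deriv l ((deriv ^^ k) f)"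
    by (rule nth_deriv_cong) (simp add: nth_deriv_def)
  then show ?thesis by (simp add: nth_deriv_def funpow_add)
qed

lemma holomorphic_diffable:
  "f holomorphic_on \<complex>\<^sub>+ \<Longrightarrow> s \<in> \<complex>\<^sub>+ \<Longrightarrow> f field_differentiable at s"
  by (rule holomorphic_on_imp_differentiable_at[OF _ open_right_half_plane])

lemma nth_deriv_diff:
  assumes "f holomorphic_on \<complex>\<^sub>+" "g holomorphic_on \<complex>\<^sub>+"
  shows "nth_deriv l (\<lambda>s\<in>\<complex>\<^sub>+. f s - g s) = (\<lambda>s\<in>\<complex>\<^sub>+. nth_deriv l f s - nth_deriv l g s)"
  unfolding nth_deriv_restrict
  by (auto simp: nth_deriv_def higher_deriv_diff[OF assms open_right_half_plane] intro!: restrict_ext)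

lemma nth_deriv_1_add:
  assumes "f holomorphic_on \<complex>\<^sub>+" "g holomorphic_on \<complex>\<^sub>+"
  shows "nth_deriv 1 (\<lambda>s\<in>\<complex>\<^sub>+. f s + g s) = (\<lambda>s\<in>\<complex>\<^sub>+. nth_deriv 1 f s + nth_deriv 1 g s)"
  unfolding nth_deriv_restrict
  using assms by (auto simp: nth_deriv_def holomorphic_diffable intro!: restrict_ext)

lemma nth_deriv_1_scale:
  assumes "f holomorphic_on \<complex>\<^sub>+"
  shows "nth_deriv 1 (\<lambda>s\<in>\<complex>\<^sub>+. c * f s) = (\<lambda>s\<in>\<complex>\<^sub>+. c * nth_deriv 1 f s)"
  unfolding nth_deriv_restrict
  using assms by (auto simp: nth_deriv_def holomorphic_diffable intro!: restrict_ext)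

text \<open>The right-hand side is a nest of restricted functions, so that it matches the closure
  rules for sums and products literally. The same holds for the quotient rule below.\<close>

lemma nth_deriv_1_mult:
  assumes "f holomorphic_on \<complex>\<^sub>+" "g holomorphic_on \<complex>\<^sub>+"
  shows "nth_deriv 1 (\<lambda>s\<in>\<complex>\<^sub>+. f s * g s)
       = (\<lambda>s\<in>\<complex>\<^sub>+. (\<lambda>s\<in>\<complex>\<^sub>+. f s * nth_deriv 1 g s) s + (\<lambda>s\<in>\<complex>\<^sub>+. nth_deriv 1 f s * g s) s)"
  unfolding nth_deriv_restrict
  using assms by (auto simp: nth_deriv_def holomorphic_diffable intro!: restrict_ext)

lemma nth_deriv_1_inverse:
  assumes "f holomorphic_on \<complex>\<^sub>+" "\<And>s. s \<in> \<complex>\<^sub>+ \<Longrightarrow> f s \<noteq> 0"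
  shows "nth_deriv 1 (\<lambda>s\<in>\<complex>\<^sub>+. 1 / f s)
       = (\<lambda>s\<in>\<complex>\<^sub>+. (-1) * (\<lambda>s\<in>\<complex>\<^sub>+. nth_deriv 1 f s *
            (\<lambda>s\<in>\<complex>\<^sub>+. (\<lambda>s\<in>\<complex>\<^sub>+. 1 / f s) s * (\<lambda>s\<in>\<complex>\<^sub>+. 1 / f s) s) s) s)"
  unfolding nth_deriv_restrict
  using assms
  by (auto simp: nth_deriv_def holomorphic_diffable divide_inverse power2_eq_square intro!: restrict_ext)

definition dirichlet_poly :: "nat \<Rightarrow> (nat \<Rightarrow> complex) \<Rightarrow> complex \<Rightarrow> complex" where
  "dirichlet_poly N a = (\<lambda>s\<in>\<complex>\<^sub>+. dirichlet_value N a (power_char s))"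

lemma dirichlet_poly_in_polynomials: "N \<ge> 1 \<Longrightarrow> dirichlet_poly N a \<in> dirichlet_polynomials"
  unfolding dirichlet_polynomials_def dirichlet_poly_def dirichlet_value_def power_char_def
    powr_minus divide_inverse by blast

lemma nth_deriv_1_dirichlet_poly:
  "nth_deriv 1 (dirichlet_poly N a) = dirichlet_poly N (\<lambda>n. - (a n * Ln (of_nat n)))"
  unfolding dirichlet_poly_def nth_deriv_restrict unfolding nth_deriv_def
proof (rule restrict_ext)
  fix s
  have "((\<lambda>s. dirichlet_value N a (power_char s)) has_field_derivative
      dirichlet_value N (\<lambda>n. - (a n * Ln (of_nat n))) (power_char s)) (at s)"
    unfolding dirichlet_value_def power_char_def
  proof (rule DERIV_sum[where f' = "\<lambda>n. - (a n * Ln (of_nat n)) * of_nat n powr (- s)"])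
    fix n assume n: "n \<in> {1..N}"
    have "((\<lambda>s. a n * exp (- s * Ln (of_nat n))) has_field_derivative
        - (a n * Ln (of_nat n)) * exp (- s * Ln (of_nat n))) (at s)"
      by (auto intro!: derivative_eq_intros)
    then show "((\<lambda>s. a n * of_nat n powr (- s)) has_field_derivative
        - (a n * Ln (of_nat n)) * of_nat n powr (- s)) (at s)"
      using n by (simp add: powr_def)
  qed
  then show "(deriv ^^ 1) (\<lambda>s. dirichlet_value N a (power_char s)) s
      = dirichlet_value N (\<lambda>n. - (a n * Ln (of_nat n))) (power_char s)"
    by (simp add: DERIV_imp_deriv)
qed

section \<open>Closure of the derivative algebras under the algebra operations and inverses\<close>

locale dirichlet_function_algebra =
  function_banach_algebra "\<complex>\<^sub>+" B nrm
  for B :: "(complex \<Rightarrow> complex) set" and nrm :: "(complex \<Rightarrow> complex) \<Rightarrow> real" +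
  assumes polynomials_subset: "dirichlet_polynomials \<subseteq> B"
    and subset_H_infty: "B \<subseteq> H_infty"
    and sup_norm_bound: "\<exists>C>0. \<forall>f\<in>B. sup_norm f \<le> C * nrm f"
    and wiener: "wiener_property B"
begin

lemma holomorphic: "f \<in> B \<Longrightarrow> f holomorphic_on \<complex>\<^sub>+"
  using subset_H_infty H_infty_holomorphic by blast

lemma nth_deriv_0_eq: "f \<in> B \<Longrightarrow> nth_deriv 0 f = f"
  using extensional nth_deriv_0 by blast

lemma deriv_algebra_0: "deriv_algebra 0 B = B"
  by (simp add: deriv_algebra_def)

text \<open>Peeling off the first derivative lets the closure properties be proved by induction on m
  with the rules for a single derivative, instead of the Leibniz formula for all orders.\<close>

lemma deriv_algebra_Suc:
  "f \<in> deriv_algebra (Suc m) B \<longleftrightarrow> f \<in> B \<and> nth_deriv 1 f \<in> deriv_algebra m B"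
proof -
  have "(\<forall>l\<in>{1..Suc m}. P l) \<longleftrightarrow> P 1 \<and> (\<forall>l\<in>{1..m}. P (l + 1))" for P
  proof -
    have "{1..Suc m} = insert 1 (Suc ` {1..m})" unfolding image_Suc_atLeastAtMost by auto
    then have "(\<forall>l\<in>{1..Suc m}. P l) \<longleftrightarrow> (\<forall>l\<in>insert 1 (Suc ` {1..m}). P l)" by (simp only:)
    also have "\<dots> \<longleftrightarrow> P 1 \<and> (\<forall>l\<in>{1..m}. P (Suc l))" by blast
    finally show ?thesis by (simp only: Suc_eq_plus1)
  qed
  then show ?thesis unfolding deriv_algebra_def nth_deriv_add by (simp add: nth_deriv_add)
qed

lemma deriv_algebra_subset: "deriv_algebra m B \<subseteq> B"
  by (auto simp: deriv_algebra_def)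

lemma deriv_algebra_Suc_subset: "deriv_algebra (Suc m) B \<subseteq> deriv_algebra m B"
  by (auto simp: deriv_algebra_def)

lemma nth_deriv_mem: "f \<in> deriv_algebra m B \<Longrightarrow> l \<le> m \<Longrightarrow> nth_deriv l f \<in> B"
  by (cases "l = 0") (auto simp: deriv_algebra_def nth_deriv_0_eq)

lemma deriv_algebra_add:
  "f \<in> deriv_algebra m B \<Longrightarrow> g \<in> deriv_algebra m B \<Longrightarrow> (\<lambda>s\<in>\<complex>\<^sub>+. f s + g s) \<in> deriv_algebra m B"
proof (induction m arbitrary: f g)
  case (Suc m)
  then show ?case
    unfolding deriv_algebra_Suc by (simp only: nth_deriv_1_add holomorphic add_closed)
qed (simp add: deriv_algebra_0 add_closed)

lemma deriv_algebra_scale: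
  "f \<in> deriv_algebra m B \<Longrightarrow> (\<lambda>s\<in>\<complex>\<^sub>+. c * f s) \<in> deriv_algebra m B"
proof (induction m arbitrary: f)
  case (Suc m)
  then show ?case
    unfolding deriv_algebra_Suc by (simp only: nth_deriv_1_scale holomorphic scale_closed)
qed (simp add: deriv_algebra_0 scale_closed)

lemma deriv_algebra_diff:
  assumes "f \<in> deriv_algebra m B" "g \<in> deriv_algebra m B"
  shows "(\<lambda>s\<in>\<complex>\<^sub>+. f s - g s) \<in> deriv_algebra m B"
proof -
  have "(\<lambda>s\<in>\<complex>\<^sub>+. f s + (\<lambda>s\<in>\<complex>\<^sub>+. (-1) * g s) s) \<in> deriv_algebra m B"
    by (intro deriv_algebra_add deriv_algebra_scale assms)
  also have "(\<lambda>s\<in>\<complex>\<^sub>+. f s + (\<lambda>s\<in>\<complex>\<^sub>+. (-1) * g s) s) = (\<lambda>s\<in>\<complex>\<^sub>+. f s - g s)"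
    by (rule restrict_ext) simp
  finally show ?thesis .
qed

text \<open>In (f g)' = f g' + f' g all four factors lie in the algebra of order m, f and g because
  the algebras decrease with m.\<close>

lemma deriv_algebra_mult:
  "f \<in> deriv_algebra m B \<Longrightarrow> g \<in> deriv_algebra m B \<Longrightarrow> (\<lambda>s\<in>\<complex>\<^sub>+. f s * g s) \<in> deriv_algebra m B"
proof (induction m arbitrary: f g)
  case (Suc m)
  note fg = Suc.prems[THEN subsetD[OF deriv_algebra_Suc_subset]]
  have B: "f \<in> B" "g \<in> B" and D: "nth_deriv 1 f \<in> deriv_algebra m B" "nth_deriv 1 g \<in> deriv_algebra m B"
    using Suc.prems by (auto simp only: deriv_algebra_Suc)
  show ?case
    unfolding deriv_algebra_Suc nth_deriv_1_mult[OF holomorphic[OF B(1)] holomorphic[OF B(2)]]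
    by (intro conjI mult_closed B deriv_algebra_add Suc.IH fg D)
qed (simp add: deriv_algebra_0 mult_closed)

text \<open>The Wiener property descends from B: once 1/f is known to lie in the algebra of order m,
  so does its derivative - f' (1/f)^2, hence 1/f lies in the one of order m + 1.\<close>

lemma deriv_algebra_inverse:
  assumes "f \<in> deriv_algebra m B" and inf: "(INF s\<in>\<complex>\<^sub>+. cmod (f s)) > 0"
  shows "(\<lambda>s\<in>\<complex>\<^sub>+. 1 / f s) \<in> deriv_algebra m B"
  using assms(1)
proof (induction m)
  case 0
  then show ?case using wiener inf unfolding deriv_algebra_0 wiener_property_def by blast
next
  case (Suc m)
  have B: "f \<in> B" and D: "nth_deriv 1 f \<in> deriv_algebra m B"
    using Suc.prems by (auto simp only: deriv_algebra_Suc)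
  have IH: "(\<lambda>s\<in>\<complex>\<^sub>+. 1 / f s) \<in> deriv_algebra m B"
    using Suc deriv_algebra_Suc_subset by blast
  have nz: "f s \<noteq> 0" if "s \<in> \<complex>\<^sub>+" for s
  proof -
    have "bdd_below ((\<lambda>s. cmod (f s)) ` \<complex>\<^sub>+)" by (rule bdd_belowI[of _ 0]) auto
    from cINF_lower[OF this that] inf show ?thesis by auto
  qed
  have "nth_deriv 1 (\<lambda>s\<in>\<complex>\<^sub>+. 1 / f s) \<in> deriv_algebra m B"
    by (subst nth_deriv_1_inverse[OF holomorphic[OF B] nz])
       (assumption | intro deriv_algebra_scale deriv_algebra_mult D IH)+
  with IH show ?case unfolding deriv_algebra_Suc using deriv_algebra_subset by blast
qed

lemma dirichlet_poly_in_deriv_algebra: "dirichlet_poly N a \<in> deriv_algebra m B"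
proof (induction m arbitrary: a)
  case 0
  show ?case
  proof (cases "N \<ge> 1")
    case True
    then show ?thesis using dirichlet_poly_in_polynomials polynomials_subset deriv_algebra_0 by blast
  next
    \<comment> \<open>\<open>dirichlet_polynomials\<close> demands at least one term, so the empty
      sum is treated as the zero function.\<close>
    case False
    then have "dirichlet_poly N a = (\<lambda>s\<in>\<complex>\<^sub>+. 0)"
      unfolding dirichlet_poly_def dirichlet_value_def by (intro restrict_ext) simp
    then show ?thesis using zero_closed deriv_algebra_0 by metis
  qed
next
  case (Suc m)
  then show ?case
    unfolding deriv_algebra_Suc nth_deriv_1_dirichlet_poly using deriv_algebra_subset by blast
qed

text \<open>The distance of B without the cut-off in \<open>norm_dist\<close>; the lemmas carry the
  membership conditions instead.\<close>

definition nrm_dist :: "(complex \<Rightarrow> complex) \<Rightarrow> (complex \<Rightarrow> complex) \<Rightarrow> real" where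
  "nrm_dist f g = nrm (\<lambda>s\<in>\<complex>\<^sub>+. f s - g s)"

lemma diff_closed: "f \<in> B \<Longrightarrow> g \<in> B \<Longrightarrow> (\<lambda>s\<in>\<complex>\<^sub>+. f s - g s) \<in> B"
  using deriv_algebra_diff[of f 0 g] by (simp add: deriv_algebra_0)

lemma nrm_dist_nonneg: "f \<in> B \<Longrightarrow> g \<in> B \<Longrightarrow> 0 \<le> nrm_dist f g"
  unfolding nrm_dist_def by (intro norm_nonneg diff_closed)

lemma nrm_dist_commute:
  assumes "f \<in> B" "g \<in> B"
  shows "nrm_dist f g = nrm_dist g f"
proof -
  have "(\<lambda>s\<in>\<complex>\<^sub>+. g s - f s) = (\<lambda>s\<in>\<complex>\<^sub>+. (-1) * (\<lambda>s\<in>\<complex>\<^sub>+. f s - g s) s)"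
    by (rule restrict_ext) simp
  then show ?thesis
    unfolding nrm_dist_def using norm_scale[OF diff_closed[OF assms], of "-1"] by simp
qed

lemma nrm_dist_zero:
  assumes "f \<in> B" "g \<in> B"
  shows "nrm_dist f g = 0 \<longleftrightarrow> f = g"
proof -
  have "(\<lambda>s\<in>\<complex>\<^sub>+. f s - g s) = (\<lambda>s\<in>\<complex>\<^sub>+. 0) \<longleftrightarrow> (\<forall>s\<in>\<complex>\<^sub>+. f s = g s)"
    by (auto simp: fun_eq_iff restrict_def)
  also have "\<dots> \<longleftrightarrow> f = g"
    using extensional assms extensionalityI[of f "\<complex>\<^sub>+" g] by auto
  finally show ?thesis
    unfolding nrm_dist_def norm_eq_zero_iff[OF diff_closed[OF assms]] .
qed

lemma nrm_dist_triangle: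
  assumes "f \<in> B" "g \<in> B" "h \<in> B"
  shows "nrm_dist f h \<le> nrm_dist f g + nrm_dist g h"
proof -
  have "(\<lambda>s\<in>\<complex>\<^sub>+. f s - h s) = (\<lambda>s\<in>\<complex>\<^sub>+. (\<lambda>s\<in>\<complex>\<^sub>+. f s - g s) s + (\<lambda>s\<in>\<complex>\<^sub>+. g s - h s) s)"
    by (rule restrict_ext) simp
  then show ?thesis
    unfolding nrm_dist_def using norm_triangle[OF diff_closed[OF assms(1,2)] diff_closed[OF assms(2,3)]] by simp
qed

abbreviation deriv_dist :: "nat \<Rightarrow> (complex \<Rightarrow> complex) \<Rightarrow> (complex \<Rightarrow> complex) \<Rightarrow> real" where
  "deriv_dist m \<equiv> norm_dist \<complex>\<^sub>+ (deriv_algebra m B) (deriv_norm m nrm)"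

lemma deriv_dist_eq:
  assumes "f \<in> deriv_algebra m B" "g \<in> deriv_algebra m B"
  shows "deriv_dist m f g = (\<Sum>l=0..m. 1 / fact l * nrm_dist (nth_deriv l f) (nth_deriv l g))"
  using assms deriv_algebra_subset holomorphic
  by (simp add: norm_dist_def deriv_norm_def nrm_dist_def nth_deriv_diff subset_iff del: nth_deriv_restrict)

lemma nrm_dist_le_deriv_dist:
  assumes "f \<in> deriv_algebra m B" "g \<in> deriv_algebra m B"
  shows "nrm_dist f g \<le> deriv_dist m f g"
proof -
  let ?F = "\<lambda>l. 1 / fact l * nrm_dist (nth_deriv l f) (nth_deriv l g)"
  have "f \<in> B" "g \<in> B" using assms deriv_algebra_subset by auto
  then have "nrm_dist f g = ?F 0" by (simp add: nth_deriv_0_eq)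
  also have "\<dots> \<le> (\<Sum>l=0..m. ?F l)"
  proof (rule member_le_sum)
    fix l assume "l \<in> {0..m} - {0}"
    then have "l \<le> m" by simp
    then have "0 \<le> nrm_dist (nth_deriv l f) (nth_deriv l g)"
      by (intro nrm_dist_nonneg nth_deriv_mem[OF assms(1)] nth_deriv_mem[OF assms(2)])
    then show "0 \<le> ?F l" by simp
  qed auto
  finally show ?thesis using deriv_dist_eq[OF assms] by simp
qed

text \<open>Turns continuity of a functional into an epsilon-delta condition. Definiteness comes
  from the term of order 0 in the norm.\<close>

lemma Metric_space_deriv_algebra: "Metric_space (deriv_algebra m B) (deriv_dist m)"
proof
  fix f g h
  have *: "0 \<le> deriv_dist m f g" if "f \<in> deriv_algebra m B" "g \<in> deriv_algebra m B" for f g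
    using nrm_dist_nonneg nrm_dist_le_deriv_dist[OF that] that deriv_algebra_subset by (meson order_trans subsetD)
  show "0 \<le> deriv_dist m f g"
  proof (cases "f \<in> deriv_algebra m B \<and> g \<in> deriv_algebra m B")
    case False
    then show ?thesis by (auto simp: norm_dist_def)
  qed (use * in blast)
  show "deriv_dist m f g = deriv_dist m g f"
  proof (cases "f \<in> deriv_algebra m B \<and> g \<in> deriv_algebra m B")
    case True
    then show ?thesis
      by (auto simp: deriv_dist_eq intro!: sum.cong nrm_dist_commute nth_deriv_mem)
  qed (auto simp: norm_dist_def)
  assume f: "f \<in> deriv_algebra m B" and g: "g \<in> deriv_algebra m B"
  then have B: "f \<in> B" "g \<in> B" using deriv_algebra_subset by auto
  show "deriv_dist m f g = 0 \<longleftrightarrow> f = g"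
  proof
    assume "deriv_dist m f g = 0"
    then have "nrm_dist f g = 0"
      using nrm_dist_le_deriv_dist[OF f g] nrm_dist_nonneg[OF B] by linarith
    then show "f = g" using nrm_dist_zero[OF B] by blast
  next
    assume "f = g"
    then show "deriv_dist m f g = 0"
      unfolding deriv_dist_eq[OF f g] using nrm_dist_zero nth_deriv_mem[OF g] by (intro sum.neutral) auto
  qed
  assume h: "h \<in> deriv_algebra m B"
  show "deriv_dist m f h \<le> deriv_dist m f g + deriv_dist m g h"
    unfolding deriv_dist_eq[OF f g] deriv_dist_eq[OF g h] deriv_dist_eq[OF f h]
      sum.distrib[symmetric] distrib_left[symmetric]
    by (intro sum_mono mult_left_mono nrm_dist_triangle nth_deriv_mem[OF f] nth_deriv_mem[OF g] nth_deriv_mem[OF h]) auto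
qed

end

section \<open>The maximal ideal space\<close>

definition power_fun :: "nat \<Rightarrow> complex \<Rightarrow> complex" where
  "power_fun n = (\<lambda>s\<in>\<complex>\<^sub>+. power_char s n)"

lemma power_fun_eq_dirichlet_poly:
  assumes "n > 0"
  shows "power_fun n = dirichlet_poly n (\<lambda>k. if k = n then 1 else 0)"
proof -
  have "dirichlet_value n (\<lambda>k. if k = n then 1 else 0) h = h n" for h
    using assms by (simp add: dirichlet_value_def if_distrib[of "\<lambda>x. x * _"] sum.delta cong: if_cong)
  then show ?thesis by (simp add: power_fun_def dirichlet_poly_def)
qed

lemma norm_power_fun_le: "n > 0 \<Longrightarrow> s \<in> \<complex>\<^sub>+ \<Longrightarrow> norm (power_fun n s) \<le> 1"
  using powr_mono[of "- Re s" 0 "real n"]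
  by (simp add: power_fun_def power_char_def norm_of_nat_powr right_half_plane_def)

context dirichlet_function_algebra
begin

lemma power_fun_mem: "n > 0 \<Longrightarrow> power_fun n \<in> deriv_algebra m B"
  using dirichlet_poly_in_deriv_algebra power_fun_eq_dirichlet_poly by metis

text \<open>This is where m >= 1 enters: f' belongs to B and is therefore bounded.\<close>

lemma deriv_algebra_approximable:
  assumes "m \<ge> 1" "f \<in> deriv_algebra m B"
  shows "dirichlet_approximable f"
proof -
  have "nth_deriv 1 f \<in> H_infty" using nth_deriv_mem[OF assms(2,1)] subset_H_infty by blast
  then obtain K where K: "\<forall>s\<in>\<complex>\<^sub>+. norm (nth_deriv 1 f s) \<le> K"
    by (auto simp: H_infty_def bounded_iff)
  have "f \<in> H_infty" using assms(2) deriv_algebra_subset subset_H_infty by blast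
  then show ?thesis
    by (rule bounded_deriv_imp_dirichlet_approximable[where K = K]) (use K in \<open>simp add: nth_deriv_def\<close>)
qed

lemma bounded_on_half_plane:
  assumes "f \<in> B"
  obtains M where "\<And>s. s \<in> \<complex>\<^sub>+ \<Longrightarrow> norm (f s) \<le> M"
proof -
  have "bounded (f ` \<complex>\<^sub>+)" using assms subset_H_infty by (auto simp: H_infty_def)
  then show ?thesis using that unfolding bounded_iff by blast
qed

lemma norm_le_sup_norm:
  assumes "f \<in> B" "s \<in> \<complex>\<^sub>+"
  shows "norm (f s) \<le> sup_norm f"
proof -
  obtain M where "\<And>s. s \<in> \<complex>\<^sub>+ \<Longrightarrow> norm (f s) \<le> M" using bounded_on_half_plane[OF assms(1)] by metis
  then have "bdd_above ((\<lambda>s. norm (f s)) ` \<complex>\<^sub>+)" by (rule bdd_aboveI2)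
  then show ?thesis unfolding sup_norm_def by (rule cSUP_upper[OF assms(2)])
qed

section \<open>Characters are contractions for the supremum norm\<close>

abbreviation character :: "nat \<Rightarrow> ((complex \<Rightarrow> complex) \<Rightarrow> complex) \<Rightarrow> bool" where
  "character m \<phi> \<equiv> \<phi> \<in> topspace (maximal_ideal_space \<complex>\<^sub>+ (deriv_algebra m B) (deriv_norm m nrm))"

lemma character_iff:
  "character m \<phi> \<longleftrightarrow> \<phi> \<in> dual_space \<complex>\<^sub>+ (deriv_algebra m B) (deriv_norm m nrm) \<and>
    (\<exists>f\<in>deriv_algebra m B. \<phi> f \<noteq> 0) \<and>
    (\<forall>f\<in>deriv_algebra m B. \<forall>g\<in>deriv_algebra m B. \<phi> (\<lambda>s\<in>\<complex>\<^sub>+. f s * g s) = \<phi> f * \<phi> g)"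
  unfolding maximal_ideal_space_def weak_star_topology_def topspace_subtopology topspace_product_topology
  by (auto simp: dual_space_def PiE_def)

text \<open>\<open>power_fun 1\<close> is the constant 1, a unit that the algebra owes to containing
  the Dirichlet polynomials.\<close>

lemma character_one:
  assumes "character m \<phi>"
  shows "\<phi> (power_fun 1) = 1"
proof -
  obtain f where f: "f \<in> deriv_algebra m B" "\<phi> f \<noteq> 0" using assms character_iff by blast
  have "(\<lambda>s\<in>\<complex>\<^sub>+. f s * power_fun 1 s) = (\<lambda>s\<in>\<complex>\<^sub>+. f s)"
    by (rule restrict_ext) (simp add: power_fun_def power_char_def)
  also have "\<dots> = f" using f(1) deriv_algebra_subset extensional extensional_restrict by blast
  finally have "\<phi> f = \<phi> f * \<phi> (power_fun 1)"
    using assms f(1) power_fun_mem[of 1 m] unfolding character_iff by (metis zero_less_one)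
  then show ?thesis using f(2) by simp
qed

lemma character_add:
  "character m \<phi> \<Longrightarrow> f \<in> deriv_algebra m B \<Longrightarrow> g \<in> deriv_algebra m B \<Longrightarrow>
   \<phi> (\<lambda>s\<in>\<complex>\<^sub>+. f s + g s) = \<phi> f + \<phi> g"
  unfolding character_iff dual_space_def by blast

lemma character_scale:
  "character m \<phi> \<Longrightarrow> f \<in> deriv_algebra m B \<Longrightarrow> \<phi> (\<lambda>s\<in>\<complex>\<^sub>+. c * f s) = c * \<phi> f"
  unfolding character_iff dual_space_def by blast

lemma character_mult:
  "character m \<phi> \<Longrightarrow> f \<in> deriv_algebra m B \<Longrightarrow> g \<in> deriv_algebra m B \<Longrightarrow>
   \<phi> (\<lambda>s\<in>\<complex>\<^sub>+. f s * g s) = \<phi> f * \<phi> g"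
  unfolding character_iff by blast

text \<open>Otherwise g = f - phi f satisfies |g| >= |phi f| - M > 0 on the half-plane, so 1/g lies
  in the algebra. But phi g = 0, whereas phi g times phi (1/g) must be 1. The constant phi f is
  entered as a multiple of \<open>power_fun 1\<close>.\<close>

lemma character_norm_le:
  assumes \<phi>: "character m \<phi>" and f: "f \<in> deriv_algebra m B"
    and M: "\<And>s. s \<in> \<complex>\<^sub>+ \<Longrightarrow> norm (f s) \<le> M"
  shows "norm (\<phi> f) \<le> M"
proof (rule ccontr)
  assume "\<not> norm (\<phi> f) \<le> M"
  then have gt: "norm (\<phi> f) - M > 0" by simp
  let ?c = "\<lambda>s\<in>\<complex>\<^sub>+. (- \<phi> f) * power_fun 1 s"
  define g where "g = (\<lambda>s\<in>\<complex>\<^sub>+. f s + ?c s)"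
  have one: "power_fun 1 \<in> deriv_algebra m B" by (rule power_fun_mem) simp
  have g: "g \<in> deriv_algebra m B"
    unfolding g_def by (intro deriv_algebra_add deriv_algebra_scale f one)
  have gs: "g s = f s - \<phi> f" if "s \<in> \<complex>\<^sub>+" for s
    using that by (simp add: g_def power_fun_def power_char_def)
  have le: "norm (\<phi> f) - M \<le> norm (g s)" if "s \<in> \<complex>\<^sub>+" for s
    using M[OF that] norm_triangle_ineq2[of "\<phi> f" "f s"] by (simp add: gs[OF that] norm_minus_commute)
  have "1 \<in> \<complex>\<^sub>+" by (simp add: right_half_plane_def)
  then have "norm (\<phi> f) - M \<le> (INF s\<in>\<complex>\<^sub>+. norm (g s))"
    by (intro cINF_greatest le) auto
  with gt have inf: "(INF s\<in>\<complex>\<^sub>+. norm (g s)) > 0" by linarith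
  note inv = deriv_algebra_inverse[OF g inf]
  have "\<phi> g = \<phi> f + \<phi> ?c"
    unfolding g_def by (rule character_add[OF \<phi> f]) (intro deriv_algebra_scale one)
  also have "\<phi> ?c = - \<phi> f" using character_scale[OF \<phi> one, of "- \<phi> f"] unfolding character_one[OF \<phi>] mult_1_right .
  finally have "\<phi> g = 0" by simp
  moreover have "(\<lambda>s\<in>\<complex>\<^sub>+. g s * (\<lambda>s\<in>\<complex>\<^sub>+. 1 / g s) s) = power_fun 1"
    unfolding power_fun_def
  proof (rule restrict_ext)
    fix s assume s: "s \<in> \<complex>\<^sub>+"
    then have "g s \<noteq> 0" using le[OF s] gt by auto
    then show "g s * (\<lambda>s\<in>\<complex>\<^sub>+. 1 / g s) s = power_char s 1" using s by (simp add: power_char_def)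
  qed
  then have "\<phi> g * \<phi> (\<lambda>s\<in>\<complex>\<^sub>+. 1 / g s) = 1"
    using character_mult[OF \<phi> g inv] character_one[OF \<phi>] by simp
  ultimately show False by simp
qed

lemma multiplicative_character:
  assumes \<phi>: "character m \<phi>"
  shows "multiplicative_char (\<lambda>n. \<phi> (power_fun n))"
  unfolding multiplicative_char_def
proof (intro conjI allI impI)
  show "\<phi> (power_fun 1) = 1" by (rule character_one[OF \<phi>])
  fix k n :: nat assume "k > 0" "n > 0"
  then have "power_fun (k * n) = (\<lambda>s\<in>\<complex>\<^sub>+. power_fun k s * power_fun n s)"
    using multiplicative_power_char unfolding power_fun_def multiplicative_char_def
    by (intro restrict_ext) simp
  then show "\<phi> (power_fun (k * n)) = \<phi> (power_fun k) * \<phi> (power_fun n)"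
    using character_mult[OF \<phi> power_fun_mem power_fun_mem] \<open>k > 0\<close> \<open>n > 0\<close> by simp
qed

lemma character_dirichlet_poly:
  assumes \<phi>: "character m \<phi>"
  shows "\<phi> (dirichlet_poly N a) = dirichlet_value N a (\<lambda>n. \<phi> (power_fun n))"
proof (induction N)
  case 0
  have "dirichlet_poly 0 a = (\<lambda>s\<in>\<complex>\<^sub>+. 0 * power_fun 1 s)"
    unfolding dirichlet_poly_def by (rule restrict_ext) (simp add: dirichlet_value_def)
  then show ?case
    using character_scale[OF \<phi> power_fun_mem, of 1 0] unfolding dirichlet_value_def by (simp only: zero_less_one mult_zero_left) simp
next
  case (Suc N)
  have mem: "(\<lambda>s\<in>\<complex>\<^sub>+. a (Suc N) * power_fun (Suc N) s) \<in> deriv_algebra m B"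
    by (intro deriv_algebra_scale power_fun_mem) simp
  have "dirichlet_poly (Suc N) a
      = (\<lambda>s\<in>\<complex>\<^sub>+. dirichlet_poly N a s + (\<lambda>s\<in>\<complex>\<^sub>+. a (Suc N) * power_fun (Suc N) s) s)"
    unfolding dirichlet_poly_def by (rule restrict_ext) (simp add: dirichlet_value_def power_fun_def)
  then have "\<phi> (dirichlet_poly (Suc N) a) = \<phi> (dirichlet_poly N a) + a (Suc N) * \<phi> (power_fun (Suc N))"
    using character_add[OF \<phi> dirichlet_poly_in_deriv_algebra mem] character_scale[OF \<phi> power_fun_mem] by simp
  then show ?case using Suc.IH by (simp add: dirichlet_value_def)
qed

text \<open>On Dirichlet polynomials both sides are evaluation at z. Both are contractions for the
  supremum norm, so a polynomial within e of f uniformly separates them by at most 2 e.\<close>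

lemma character_eq_char_ext:
  assumes m: "m \<ge> 1" and \<phi>: "character m \<phi>" and f: "f \<in> deriv_algebra m B"
    and z: "z \<in> polydisc" "\<And>p. prime p \<Longrightarrow> z p = \<phi> (power_fun p)"
  shows "\<phi> f = char_ext z f"
proof -
  note apx = deriv_algebra_approximable[OF m f]
  have "norm (\<phi> f - char_ext z f) \<le> 2 * e" if "e > 0" for e
  proof -
    have "\<exists>N a. dirichlet_approx f e N a"
      using apx \<open>e > 0\<close> unfolding dirichlet_approximable_def by blast
    then obtain N a where P: "dirichlet_approx f e N a" by blast
    let ?P = "dirichlet_poly N a"
    have mem: "(\<lambda>s\<in>\<complex>\<^sub>+. (-1) * f s) \<in> deriv_algebra m B" by (rule deriv_algebra_scale[OF f])
    have "norm (\<phi> (\<lambda>s\<in>\<complex>\<^sub>+. ?P s + (\<lambda>s\<in>\<complex>\<^sub>+. (-1) * f s) s)) \<le> e"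
    proof (rule character_norm_le[OF \<phi>])
      show "(\<lambda>s\<in>\<complex>\<^sub>+. ?P s + (\<lambda>s\<in>\<complex>\<^sub>+. (-1) * f s) s) \<in> deriv_algebra m B"
        by (intro deriv_algebra_add dirichlet_poly_in_deriv_algebra mem)
      fix s assume "s \<in> \<complex>\<^sub>+"
      then show "norm ((\<lambda>s\<in>\<complex>\<^sub>+. ?P s + (\<lambda>s\<in>\<complex>\<^sub>+. (-1) * f s) s) s) \<le> e"
        using dirichlet_approxD[OF P] by (simp add: dirichlet_poly_def)
    qed
    also have "\<phi> (\<lambda>s\<in>\<complex>\<^sub>+. ?P s + (\<lambda>s\<in>\<complex>\<^sub>+. (-1) * f s) s) = \<phi> ?P - \<phi> f"
      using character_add[OF \<phi> dirichlet_poly_in_deriv_algebra mem] character_scale[OF \<phi> f, of "-1"] by simp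
    also have "\<phi> ?P = dirichlet_value N a (prime_char z)"
      unfolding character_dirichlet_poly[OF \<phi>]
      by (intro dirichlet_value_cong prime_char_unique multiplicative_character[OF \<phi>]) (simp_all add: z)
    finally have "norm (dirichlet_value N a (prime_char z) - \<phi> f) \<le> e" .
    moreover have "norm (dirichlet_value N a (prime_char z) - char_ext z f) \<le> e"
      by (rule char_ext_approx[OF z(1) apx P])
    ultimately show ?thesis
      using norm_triangle_ineq4[of "dirichlet_value N a (prime_char z) - char_ext z f" "dirichlet_value N a (prime_char z) - \<phi> f"]
      by simp
  qed
  from this[of "e / 2" for e] have "norm (\<phi> f - char_ext z f) \<le> e" if "e > 0" for e using that by simp
  then have "norm (\<phi> f - char_ext z f) \<le> 0" by (rule field_le_epsilon[of _ 0, simplified])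
  then show ?thesis by simp
qed

section \<open>Points of the polydisc give characters\<close>

lemma char_ext_diff:
  assumes m: "m \<ge> 1" and z: "z \<in> polydisc" and f: "f \<in> deriv_algebra m B" and g: "g \<in> deriv_algebra m B"
  shows "char_ext z (\<lambda>s\<in>\<complex>\<^sub>+. f s - g s) = char_ext z f - char_ext z g"
  using char_ext_add[OF z deriv_algebra_approximable[OF m deriv_algebra_diff[OF f g]]
      deriv_algebra_approximable[OF m g], of f] by simp

text \<open>Scaling by c is multiplication by the one-term Dirichlet polynomial c 1^(-s), so
  \<open>char_ext_mult\<close> applies.\<close>

lemma char_ext_scale:
  assumes m: "m \<ge> 1" and z: "z \<in> polydisc" and f: "f \<in> deriv_algebra m B"
  shows "char_ext z (\<lambda>s\<in>\<complex>\<^sub>+. c * f s) = c * char_ext z f"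
proof -
  let ?c = "\<lambda>n. if n = 1 then c else 0"
  obtain M where M: "\<And>s. s \<in> \<complex>\<^sub>+ \<Longrightarrow> norm (f s) \<le> M"
    using f deriv_algebra_subset bounded_on_half_plane by blast
  have c: "dirichlet_value 1 ?c h = c * h 1" for h by (simp add: dirichlet_value_def)
  have val: "char_ext z (dirichlet_poly 1 ?c) = c"
    by (subst char_ext_value[OF z, of _ 1 ?c])
       (simp_all add: dirichlet_poly_def c[simplified] prime_char_def)
  have "char_ext z (\<lambda>s\<in>\<complex>\<^sub>+. c * f s) = char_ext z (dirichlet_poly 1 ?c) * char_ext z f"
  proof (rule char_ext_mult[OF z])
    show "dirichlet_approximable (dirichlet_poly 1 ?c)" "dirichlet_approximable f"
      by (intro deriv_algebra_approximable[OF m] dirichlet_poly_in_deriv_algebra f)+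
    fix s assume s: "s \<in> \<complex>\<^sub>+"
    then have eq: "dirichlet_poly 1 ?c s = c"
      by (simp add: dirichlet_poly_def c[simplified] power_char_def)
    then show "norm (dirichlet_poly 1 ?c s) \<le> norm c" by simp
    show "norm (f s) \<le> M" by (rule M[OF s])
    show "(\<lambda>s\<in>\<complex>\<^sub>+. c * f s) s = dirichlet_poly 1 ?c s * f s" unfolding eq using s by simp
  qed
  then show ?thesis unfolding val .
qed

lemma character_char_ext:
  assumes m: "m \<ge> 1" and z: "z \<in> polydisc"
  shows "character m (restrict (char_ext z) (deriv_algebra m B))"
proof -
  let ?A = "deriv_algebra m B"
  let ?\<phi> = "restrict (char_ext z) ?A"
  interpret M: Metric_space ?A "deriv_dist m" by (rule Metric_space_deriv_algebra)
  obtain C where C: "C > 0" "\<And>f. f \<in> B \<Longrightarrow> sup_norm f \<le> C * nrm f"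
    using sup_norm_bound by blast
  \<comment> \<open>The difference is at most sup |f - g|, hence at most C times the distance in B,
    which is the term of order 0 of the distance in the derivative algebra.\<close>
  have lip: "dist (char_ext z f) (char_ext z g) \<le> C * deriv_dist m f g" if f: "f \<in> ?A" and g: "g \<in> ?A" for f g
  proof -
    have d: "(\<lambda>s\<in>\<complex>\<^sub>+. f s - g s) \<in> ?A" by (rule deriv_algebra_diff[OF f g])
    then have dB: "(\<lambda>s\<in>\<complex>\<^sub>+. f s - g s) \<in> B" using deriv_algebra_subset by blast
    have "norm (char_ext z (\<lambda>s\<in>\<complex>\<^sub>+. f s - g s)) \<le> sup_norm (\<lambda>s\<in>\<complex>\<^sub>+. f s - g s)"
      by (intro char_ext_norm_le[OF z] deriv_algebra_approximable[OF m d] norm_le_sup_norm[OF dB])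
    also have "\<dots> \<le> C * nrm_dist f g" unfolding nrm_dist_def by (rule C(2)[OF dB])
    also have "\<dots> \<le> C * deriv_dist m f g"
      using C(1) by (intro mult_left_mono nrm_dist_le_deriv_dist f g) auto
    finally show ?thesis unfolding char_ext_diff[OF m z f g] dist_norm .
  qed
  have cont: "continuous_map M.mtopology euclidean ?\<phi>"
    unfolding M.continuous_map_from_metric
  proof (intro conjI ballI allI impI)
    fix f U assume f: "f \<in> ?A" and U: "openin euclidean U \<and> ?\<phi> f \<in> U"
    then have "open U" "?\<phi> f \<in> U" by (simp_all only: open_openin)
    then obtain e where e: "e > 0" "ball (?\<phi> f) e \<subseteq> U" using open_contains_ball by blast
    show "\<exists>r>0. \<forall>g. g \<in> ?A \<and> deriv_dist m f g < r \<longrightarrow> ?\<phi> g \<in> U"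
    proof (intro exI[of _ "e / C"] conjI allI impI)
      show "e / C > 0" using e C by simp
      fix g assume g: "g \<in> ?A \<and> deriv_dist m f g < e / C"
      then have "C * deriv_dist m f g < e" using C(1) by (simp add: field_simps)
      then have "dist (char_ext z f) (char_ext z g) < e" using lip[OF f] g by fastforce
      then have "?\<phi> g \<in> ball (?\<phi> f) e" using f g by simp
      then show "?\<phi> g \<in> U" using e(2) by blast
    qed
  qed simp
  have apx: "dirichlet_approximable f" if "f \<in> ?A" for f by (rule deriv_algebra_approximable[OF m that])
  have add: "?\<phi> (\<lambda>s\<in>\<complex>\<^sub>+. f s + g s) = ?\<phi> f + ?\<phi> g" if f: "f \<in> ?A" and g: "g \<in> ?A" for f g
    using char_ext_add[OF z apx[OF f] apx[OF g], of "\<lambda>s\<in>\<complex>\<^sub>+. f s + g s"] deriv_algebra_add[OF f g] f g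
    by (simp only: restrict_apply' )
  have scale: "?\<phi> (\<lambda>s\<in>\<complex>\<^sub>+. c * f s) = c * ?\<phi> f" if f: "f \<in> ?A" for f c
    using char_ext_scale[OF m z f] deriv_algebra_scale[OF f] f by (simp only: restrict_apply')
  have mult: "?\<phi> (\<lambda>s\<in>\<complex>\<^sub>+. f s * g s) = ?\<phi> f * ?\<phi> g" if f: "f \<in> ?A" and g: "g \<in> ?A" for f g
  proof -
    obtain L M where "\<And>s. s \<in> \<complex>\<^sub>+ \<Longrightarrow> norm (f s) \<le> L" "\<And>s. s \<in> \<complex>\<^sub>+ \<Longrightarrow> norm (g s) \<le> M"
      using bounded_on_half_plane f g deriv_algebra_subset by (metis subsetD)
    from char_ext_mult[OF z apx[OF f] apx[OF g] this, of "\<lambda>s\<in>\<complex>\<^sub>+. f s * g s"]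
    show ?thesis using deriv_algebra_mult[OF f g] f g by (simp only: restrict_apply')
  qed
  have "char_ext z (power_fun 1) = 1"
    by (subst char_ext_value[OF z, of _ 1 "\<lambda>_. 1"])
       (simp_all add: power_fun_def dirichlet_value_def prime_char_def)
  then have "\<exists>f\<in>?A. ?\<phi> f \<noteq> 0"
    using power_fun_mem[of 1 m] by (intro bexI[of _ "power_fun 1"]) auto
  with add scale mult cont show ?thesis
    unfolding character_iff dual_space_def by blast
qed

lemma char_ext_power_fun:
  assumes "z \<in> polydisc" "prime p"
  shows "char_ext z (power_fun p) = z p"
proof -
  have p: "p > 0" using assms(2) prime_gt_0_nat by blast
  have "dirichlet_value p (\<lambda>k. if k = p then 1 else 0) h = h p" for h
    using p by (simp add: dirichlet_value_def if_distrib[of "\<lambda>x. x * _"] sum.delta cong: if_cong)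
  then have "char_ext z (power_fun p) = prime_char z p"
    by (subst char_ext_value[OF assms(1), of _ p "\<lambda>k. if k = p then 1 else 0"]) (simp_all add: power_fun_def)
  then show ?thesis using assms(2) by (simp add: prime_char_def prime_factorization_prime)
qed

text \<open>One approximating polynomial has error e/3 at every point of the polydisc, and its value
  is continuous because it involves finitely many coordinates. The three thirds are two
  approximation errors and the variation of the polynomial.\<close>

lemma char_ext_continuous:
  assumes z: "\<And>x. x \<in> topspace X \<Longrightarrow> z x \<in> polydisc"
    and cont: "\<And>p. continuous_map X euclidean (\<lambda>x. z x p)" and f: "dirichlet_approximable f"
  shows "continuous_map X euclidean (\<lambda>x. char_ext (z x) f)"
  unfolding continuous_map_atin limitin_canonical_iff
proof (intro ballI tendstoI)
  fix x e assume x: "x \<in> topspace X" and "(e :: real) > 0"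
  then have "e / 3 > 0" by simp
  then obtain N a where P: "dirichlet_approx f (e / 3) N a"
    using f unfolding dirichlet_approximable_def by blast
  let ?P = "\<lambda>x. dirichlet_value N a (prime_char (z x))"
  have "((\<lambda>y. z y p) \<longlongrightarrow> z x p) (atin X x)" for p
    using cont x unfolding continuous_map_atin limitin_canonical_iff by blast
  then have "(?P \<longlongrightarrow> ?P x) (atin X x)"
    unfolding dirichlet_value_def by (intro tendsto_intros prime_char_tendsto)
  then have ev: "\<forall>\<^sub>F y in atin X x. dist (?P y) (?P x) < e / 3" using \<open>e / 3 > 0\<close> by (rule tendstoD)
  have ev': "\<forall>\<^sub>F y in atin X x. y \<in> topspace X" using x by (auto simp: eventually_atin)
  from ev ev' show "\<forall>\<^sub>F y in atin X x. dist (char_ext (z y) f) (char_ext (z x) f) < e"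
  proof eventually_elim
    case (elim y)
    have "dist (?P y) (char_ext (z y) f) \<le> e / 3" "dist (?P x) (char_ext (z x) f) \<le> e / 3"
      unfolding dist_norm by (intro char_ext_approx[OF z f P] x elim)+
    then show ?case
      using elim(1) dist_triangle[of "char_ext (z y) f" "char_ext (z x) f" "?P y"]
        dist_triangle[of "?P y" "char_ext (z x) f" "?P x"] by (simp add: dist_commute)
  qed
qed

lemma maximal_ideal_space_homeomorphic_polydisc:
  assumes m: "m \<ge> 1"
  shows "maximal_ideal_space \<complex>\<^sub>+ (deriv_algebra m B) (deriv_norm m nrm) homeomorphic_space
         product_topology (\<lambda>_ :: nat. top_of_set (cball (0 :: complex) 1)) UNIV"
proof -
  let ?A = "deriv_algebra m B"
  let ?M = "maximal_ideal_space \<complex>\<^sub>+ ?A (deriv_norm m nrm)"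
  let ?D = "product_topology (\<lambda>_ :: nat. top_of_set (cball (0 :: complex) 1)) UNIV"
  obtain e :: "nat \<Rightarrow> nat" where e: "bij_betw e UNIV {p. prime p}"
    using countable_infiniteE'[OF countableI_type primes_infinite] by blast
  have prime_e: "prime (e k)" for k using e by (auto simp: bij_betw_def)
  have inv_e: "inv e (e k) = k" for k using e by (simp add: bij_betw_def)
  have e_inv: "e (inv e p) = p" if "prime p" for p using e that by (simp add: bij_betw_def f_inv_into_f)
  define F where "F \<phi> k = \<phi> (power_fun (e k))" for \<phi> :: "(complex \<Rightarrow> complex) \<Rightarrow> complex" and k
  \<comment> \<open>Transport along the enumeration e of the primes. At a non-prime p the index
    \<open>inv e p\<close> is arbitrary, but \<open>prime_char\<close> never reads that
    coordinate.\<close>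
  define z where "z x p = x (inv e p)" for x :: "nat \<Rightarrow> complex" and p
  define G where "G x = restrict (char_ext (z x)) ?A" for x
  have topD: "x \<in> topspace ?D \<longleftrightarrow> (\<forall>k. norm (x k) \<le> 1)" for x
    by (auto simp: PiE_UNIV_domain)
  have z: "z x \<in> polydisc" if "x \<in> topspace ?D" for x
    using that unfolding topD polydisc_def z_def by blast
  have mem: "power_fun (e k) \<in> ?A" for k by (rule power_fun_mem) (simp add: prime_e prime_gt_0_nat)
  have F_in: "F \<phi> \<in> topspace ?D" if "\<phi> \<in> topspace ?M" for \<phi>
    unfolding topD F_def
    by (intro allI character_norm_le[OF that mem] norm_power_fun_le) (simp_all add: prime_e prime_gt_0_nat)
  have cont_F: "continuous_map ?M ?D F"
    unfolding continuous_map_componentwise_UNIV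
  proof
    fix k
    show "continuous_map ?M (top_of_set (cball 0 1)) (\<lambda>\<phi>. F \<phi> k)"
    proof (rule continuous_map_into_subtopology)
      \<comment> \<open>In the weak-* topology, evaluation at a fixed element of the algebra is a
        coordinate projection.\<close>
      show "continuous_map ?M euclidean (\<lambda>\<phi>. F \<phi> k)"
        unfolding maximal_ideal_space_def weak_star_topology_def F_def
        by (intro continuous_map_from_subtopology continuous_map_product_projection mem)
      show "(\<lambda>\<phi>. F \<phi> k) \<in> topspace ?M \<rightarrow> cball 0 1"
        using F_in unfolding topD by simp
    qed
  qed
  have G_in: "G x \<in> topspace ?M" if "x \<in> topspace ?D" for x
    unfolding G_def by (rule character_char_ext[OF m z[OF that]])
  have cont_G: "continuous_map ?D ?M G"
  proof -
    have "continuous_map ?D (product_topology (\<lambda>_. euclidean) ?A) G"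
      unfolding continuous_map_componentwise
    proof (intro conjI ballI)
      show "G ` topspace ?D \<subseteq> extensional ?A" by (auto simp: G_def)
      fix f assume f: "f \<in> ?A"
      have "continuous_map ?D euclidean (\<lambda>x. char_ext (z x) f)"
      proof (rule char_ext_continuous[OF z _ deriv_algebra_approximable[OF m f]])
        fix p
        have "continuous_map ?D (top_of_set (cball 0 1)) (\<lambda>x. x (inv e p))"
          by (rule continuous_map_product_projection) simp
        then show "continuous_map ?D euclidean (\<lambda>x. z x p)"
          unfolding z_def by (rule continuous_map_into_fulltopology)
      qed
      then show "continuous_map ?D euclidean (\<lambda>x. G x f)" using f by (simp add: G_def)
    qed
    then show ?thesis
      using G_in unfolding maximal_ideal_space_def weak_star_topology_def
      by (simp add: continuous_map_in_subtopology Pi_iff)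
  qed
  have GF: "G (F \<phi>) = \<phi>" if \<phi>: "\<phi> \<in> topspace ?M" for \<phi>
  proof (rule extensionalityI)
    show "G (F \<phi>) \<in> extensional ?A" by (simp add: G_def)
    show "\<phi> \<in> extensional ?A" using \<phi> by (simp add: character_iff dual_space_def)
    fix f assume f: "f \<in> ?A"
    have "\<phi> f = char_ext (z (F \<phi>)) f"
      by (rule character_eq_char_ext[OF m \<phi> f z[OF F_in[OF \<phi>]]]) (simp add: z_def F_def e_inv)
    then show "G (F \<phi>) f = \<phi> f" using f by (simp add: G_def)
  qed
  have FG: "F (G x) = x" if "x \<in> topspace ?D" for x
  proof
    fix k show "F (G x) k = x k"
      using mem[of k] char_ext_power_fun[OF z[OF that] prime_e] by (simp add: F_def G_def z_def inv_e)
  qed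
  show ?thesis
    unfolding homeomorphic_space_def homeomorphic_maps_def
    using cont_F cont_G GF FG by blast
qed

end

theorem theorem1p2:
  fixes m :: nat
    and B :: "(complex \<Rightarrow> complex) set"
    and nrm :: "(complex \<Rightarrow> complex) \<Rightarrow> real"
  assumes "m \<ge> 1"
    and "function_banach_algebra \<complex>\<^sub>+ B nrm"
    and "dirichlet_polynomials \<subseteq> B" and "B \<subseteq> H_infty"
    and "\<exists>C>0. \<forall>f\<in>B. sup_norm f \<le> C * nrm f"
    and "wiener_property B"
  shows "maximal_ideal_space \<complex>\<^sub>+ (deriv_algebra m B) (deriv_norm m nrm)
           homeomorphic_space
         product_topology (\<lambda>_ :: nat. top_of_set (cball (0 :: complex) 1)) UNIV"
proof -
  interpret dirichlet_function_algebra B nrm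
    using assms by (simp add: dirichlet_function_algebra_def dirichlet_function_algebra_axioms_def)
  show ?thesis by (rule maximal_ideal_space_homeomorphic_polydisc[OF assms(1)])
qed

end
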